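(* For every $n\ge 5$ there exist unbounded homogeneous domains $\Omega_1,\Omega_2\subset\mathbb{C}^n$ which are not biholomorphically equivalent, while their automorphism groups $\mathrm{Aut}(\Omega_1)$ and $\mathrm{Aut}(\Omega_2)$ are isomorphic.
   Context: A domain $\Omega$ is homogeneous if its group $\mathrm{Aut}(\Omega)$ of biholomorphic self-maps acts transitively on $\Omega$. *)

theory Defs
  imports "HOL-Analysis.Analysis"
begin

definition holo_on :: "(complex ^ 'n \<Rightarrow> complex ^ 'm) \<Rightarrow> (complex ^ 'n) set \<Rightarrow> bool" where
  "holo_on f S \<longleftrightarrow> (\<forall>x\<in>S. \<exists>L. linear L \<and> (\<forall>(c::complex) v. L (c *s v) = c *s L v)
        \<and> (f has_derivative L) (at x))"

definition is_domain :: "(complex ^ 'n) set \<Rightarrow> bool" where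
  "is_domain D \<longleftrightarrow> open D \<and> connected D \<and> D \<noteq> {}"

definition biholo :: "(complex ^ 'n \<Rightarrow> complex ^ 'm) \<Rightarrow> (complex ^ 'n) set \<Rightarrow> (complex ^ 'm) set \<Rightarrow> bool" where
  "biholo f A B \<longleftrightarrow> holo_on f A \<and> bij_betw f A B \<and>
     (\<exists>g. holo_on g B \<and> (\<forall>x\<in>A. g (f x) = x))"

definition biholo_equiv :: "(complex ^ 'n) set \<Rightarrow> (complex ^ 'm) set \<Rightarrow> bool" where
  "biholo_equiv A B \<longleftrightarrow> (\<exists>f. biholo f A B)"

text \<open>Aut(D): biholomorphic self-maps of D, normalised to be the identity outside D,
  so that each automorphism is represented by exactly one HOL function.\<close>
definition Aut :: "(complex ^ 'n) set \<Rightarrow> (complex ^ 'n \<Rightarrow> complex ^ 'n) set" where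
  "Aut D = {f. biholo f D D \<and> (\<forall>x. x \<notin> D \<longrightarrow> f x = x)}"

definition homogeneous :: "(complex ^ 'n) set \<Rightarrow> bool" where
  "homogeneous D \<longleftrightarrow> (\<forall>p\<in>D. \<forall>q\<in>D. \<exists>f\<in>Aut D. f p = q)"

definition loc_unif_conv :: "(complex ^ 'n) set \<Rightarrow> (nat \<Rightarrow> complex ^ 'n \<Rightarrow> complex ^ 'n)
     \<Rightarrow> (complex ^ 'n \<Rightarrow> complex ^ 'n) \<Rightarrow> bool" where
  "loc_unif_conv D F f \<longleftrightarrow> (\<forall>K. compact K \<and> K \<subseteq> D \<longrightarrow> uniform_limit K F f sequentially)"

text \<open>Isomorphism of automorphism groups as topological groups (equivalently, Lie groups):
  a group isomorphism for composition, sequentially bicontinuous for the compact-open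
  topology (which is metrizable on Aut D).\<close>
definition aut_iso :: "(complex ^ 'n) set \<Rightarrow> (complex ^ 'n) set
     \<Rightarrow> ((complex ^ 'n \<Rightarrow> complex ^ 'n) \<Rightarrow> (complex ^ 'n \<Rightarrow> complex ^ 'n)) \<Rightarrow> bool" where
  "aut_iso D1 D2 \<Phi> \<longleftrightarrow> bij_betw \<Phi> (Aut D1) (Aut D2)
     \<and> (\<forall>f\<in>Aut D1. \<forall>g\<in>Aut D1. \<Phi> (f \<circ> g) = \<Phi> f \<circ> \<Phi> g)
     \<and> (\<forall>F f. (\<forall>k. F k \<in> Aut D1) \<and> f \<in> Aut D1 \<and> loc_unif_conv D1 F f
              \<longrightarrow> loc_unif_conv D2 (\<lambda>k. \<Phi> (F k)) (\<Phi> f))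
     \<and> (\<forall>F f. (\<forall>k. F k \<in> Aut D1) \<and> f \<in> Aut D1 \<and> loc_unif_conv D2 (\<lambda>k. \<Phi> (F k)) (\<Phi> f)
              \<longrightarrow> loc_unif_conv D1 F f)"

end

theory Submission
  imports Defs "HOL-Complex_Analysis.Conformal_Mappings"
begin

text \<open>
  Split the coordinates of \<open>\<complex>\<^sup>n\<close> into two blocks of sizes \<open>2\<close> and \<open>n - 2 \<ge> 3\<close> and let \<open>h\<close> be the
  Hermitian form of signature \<open>(2, n - 2)\<close>. The domains are the cones \<open>h > 0\<close> and \<open>h < 0\<close>.
  Each is homogeneous under scalars and the unitary group of \<open>h\<close>. Since both blocks have size at
  least \<open>2\<close>, holomorphic functions on either cone extend to \<open>\<complex>\<^sup>n\<close> (Hartogs), so an automorphism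
  of one cone extends to an automorphism of \<open>\<complex>\<^sup>n\<close>; being a homeomorphism that preserves the cone, it
  also preserves the interior of the complement, which is the other cone. Restricting to the other
  cone is the isomorphism of automorphism groups. The cones are not even homeomorphic, being homotopy
  equivalent to spheres of the different dimensions \<open>3\<close> and \<open>2n - 5\<close>.
\<close>

section \<open>Holomorphic functions of several variables\<close>

text \<open>Scalar values let one-variable complex analysis act along complex lines on each
  component of a \<open>holo_on\<close> map.\<close>

definition cdiff_on :: "(complex ^ 'n \<Rightarrow> complex) \<Rightarrow> (complex ^ 'n) set \<Rightarrow> bool" where
  "cdiff_on u S \<longleftrightarrow> (\<forall>x\<in>S. \<exists>L. linear L \<and> (\<forall>(c::complex) v. L (c *s v) = c * L v)
        \<and> (u has_derivative L) (at x))"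

lemma has_derivative_vec_componentwise:
  fixes f :: "'a::euclidean_space \<Rightarrow> complex ^ 'n"
  shows "(f has_derivative L) (at x) \<longleftrightarrow> (\<forall>i. ((\<lambda>x. f x $ i) has_derivative (\<lambda>v. L v $ i)) (at x))"
proof
  assume "(f has_derivative L) (at x)"
  then show "\<forall>i. ((\<lambda>x. f x $ i) has_derivative (\<lambda>v. L v $ i)) (at x)"
    using bounded_linear.has_derivative[OF bounded_linear_vec_nth] by blast
next
  assume *: "\<forall>i. ((\<lambda>x. f x $ i) has_derivative (\<lambda>v. L v $ i)) (at x)"
  show "(f has_derivative L) (at x)"
  proof (subst has_derivative_componentwise_within, intro ballI)
    fix b :: "complex ^ 'n" assume "b \<in> Basis"
    then obtain i u where b: "b = axis i u" by (auto simp: Basis_vec_def)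
    show "((\<lambda>x. f x \<bullet> b) has_derivative (\<lambda>x. L x \<bullet> b)) (at x)"
      unfolding b inner_axis by (intro has_derivative_inner_left *[rule_format])
  qed
qed

lemma holo_on_iff_components: "holo_on f S \<longleftrightarrow> (\<forall>i. cdiff_on (\<lambda>x. f x $ i) S)"
proof
  assume f: "holo_on f S"
  show "\<forall>i. cdiff_on (\<lambda>x. f x $ i) S"
    unfolding cdiff_on_def
  proof (intro allI ballI)
    fix i x assume "x \<in> S"
    then obtain L where L: "linear L" "\<forall>(c::complex) v. L (c *s v) = c *s L v"
      "(f has_derivative L) (at x)"
      using f unfolding holo_on_def by blast
    show "\<exists>L. linear L \<and> (\<forall>(c::complex) v. L (c *s v) = c * L v) \<and> ((\<lambda>x. f x $ i) has_derivative L) (at x)"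
      using L(2) L(3)[unfolded has_derivative_vec_componentwise, rule_format, of i]
      by (intro exI[of _ "\<lambda>v. L v $ i"]) (auto dest: has_derivative_linear)
  qed
next
  assume f: "\<forall>i. cdiff_on (\<lambda>x. f x $ i) S"
  show "holo_on f S"
    unfolding holo_on_def
  proof
    fix x assume "x \<in> S"
    then have "\<forall>i. \<exists>L. linear L \<and> (\<forall>(c::complex) v. L (c *s v) = c * L v) \<and> ((\<lambda>x. f x $ i) has_derivative L) (at x)"
      using f unfolding cdiff_on_def by blast
    then obtain L where L: "\<And>i. linear (L i)" "\<And>i (c::complex) v. L i (c *s v) = c * L i v"
      "\<And>i. ((\<lambda>x. f x $ i) has_derivative L i) (at x)" by metis
    define M where "M v = (\<chi> i. L i v)" for v
    have "(f has_derivative M) (at x)"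
      unfolding has_derivative_vec_componentwise M_def using L(3) by simp
    moreover have "M (c *s v) = c *s M v" for c v
      by (simp add: M_def L(2) vec_eq_iff)
    ultimately show "\<exists>L. linear L \<and> (\<forall>(c::complex) v. L (c *s v) = c *s L v) \<and> (f has_derivative L) (at x)"
      by (auto dest: has_derivative_linear)
  qed
qed

lemma norm_vector_scalar_mult: "norm (c *s v) = norm (c::complex) * norm (v :: complex ^ 'n)"
  by (simp add: norm_vec_def norm_mult L2_set_right_distrib)

lemma bounded_linear_scalar_mult_left: "bounded_linear (\<lambda>c::complex. c *s (v :: complex ^ 'n))"
  by (rule bounded_linear_intro[where K="norm v"])
     (simp_all add: norm_vector_scalar_mult vec_eq_iff algebra_simps)

lemma has_field_derivative_line:
  fixes u :: "complex ^ 'n \<Rightarrow> complex"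
  assumes "(u has_derivative L) (at (x + t *s v))" "\<And>(c::complex) v. L (c *s v) = c * L v"
  shows "((\<lambda>t. u (x + t *s v)) has_field_derivative L v) (at t)"
proof -
  have "((\<lambda>t. x + t *s v) has_derivative (\<lambda>t. t *s v)) (at t)"
    using has_derivative_add[OF has_derivative_const
        bounded_linear.has_derivative[OF bounded_linear_scalar_mult_left has_derivative_ident]]
    by simp
  from has_derivative_compose[OF this assms(1)]
  show ?thesis
    unfolding has_field_derivative_def by (simp add: assms(2) mult_commute_abs)
qed

lemma cdiff_on_imp_holomorphic_on_line:
  assumes "cdiff_on u S" "\<And>t. t \<in> T \<Longrightarrow> x + t *s v \<in> S"
  shows "(\<lambda>t. u (x + t *s v)) holomorphic_on T"
  unfolding holomorphic_on_def
proof
  fix t assume "t \<in> T"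
  then obtain L where "(u has_derivative L) (at (x + t *s v))" "\<And>(c::complex) v. L (c *s v) = c * L v"
    using assms unfolding cdiff_on_def by blast
  from has_field_derivative_line[OF this] show "(\<lambda>t. u (x + t *s v)) field_differentiable at t within T"
    using field_differentiable_at_within field_differentiable_def by blast
qed

lemma cdiff_on_imp_continuous_on: "cdiff_on u S \<Longrightarrow> continuous_on S u"
  unfolding cdiff_on_def by (meson has_derivative_continuous continuous_at_imp_continuous_on)

lemma cdiff_on_subset: "cdiff_on u S \<Longrightarrow> T \<subseteq> S \<Longrightarrow> cdiff_on u T"
  unfolding cdiff_on_def by blast

text \<open>Restrict \<open>u\<close> to the line \<open>y + t *s v\<close> and combine Cauchy's
  estimate for the second derivative with Taylor's formula from \<open>t = 0\<close> to
  \<open>t = 1\<close>. The constant is independent of \<open>v\<close> and depends on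
  \<open>y\<close> only through \<open>r\<close> and \<open>M\<close>, which is the uniformity
  needed to differentiate under an integral.\<close>

lemma cdiff_on_quadratic_remainder:
  fixes u :: "complex ^ 'n \<Rightarrow> complex"
  assumes u: "cdiff_on u S" and r: "0 < r" "cball y (2 * r) \<subseteq> S"
    and M: "\<And>z. z \<in> cball y (2 * r) \<Longrightarrow> norm (u z) \<le> M"
    and L: "(u has_derivative L) (at y)" "\<And>(c::complex) v. L (c *s v) = c * L v"
    and v: "norm v \<le> r"
  shows "norm (u (y + v) - u y - L v) \<le> 2 * M / r\<^sup>2 * (norm v)\<^sup>2"
proof (cases "v = 0")
  case True
  then show ?thesis using L(2)[of 0 0] by simp
next
  case False
  define g where "g t = u (y + t *s v)" for t
  \<comment> \<open>Up to this radius the line stays in \<open>cball y (2 * r)\<close>. As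
    \<open>norm v \<le> r\<close>, a disc of radius \<open>r / norm v\<close> about any point of the
    unit disc still fits inside.\<close>
  define R where "R = 2 * r / norm v"
  have "norm (t *s v) \<le> 2 * r" if "t \<in> cball 0 R" for t
    using that False r by (simp add: norm_vector_scalar_mult R_def field_simps)
  then have incl: "y + t *s v \<in> cball y (2 * r)" if "t \<in> cball 0 R" for t
    using that by (simp add: dist_norm)
  have R2: "r / norm v \<ge> 1" using v False by (simp add: field_simps)
  have hol: "g holomorphic_on cball 0 R"
    unfolding g_def using u incl r by (intro cdiff_on_imp_holomorphic_on_line) auto
  have gM: "norm (g t) \<le> M" if "t \<in> cball 0 R" for t
    unfolding g_def using M incl that by blast
  have hol': "g holomorphic_on ball 0 R"
    using hol ball_subset_cball holomorphic_on_subset by blast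
  have d2: "norm ((deriv ^^ 2) g t) \<le> fact 2 * M / (r / norm v)^2" if "t \<in> cball 0 1" for t
  proof (rule Cauchy_inequality)
    have sub: "cball t (r / norm v) \<subseteq> cball 0 R"
    proof
      fix s assume "s \<in> cball t (r / norm v)"
      moreover have "dist 0 s \<le> dist 0 t + dist t s" by (rule dist_triangle)
      ultimately show "s \<in> cball 0 R" using that R2 by (simp add: R_def)
    qed
    show "g holomorphic_on ball t (r / norm v)"
      using hol sub ball_subset_cball holomorphic_on_subset by blast
    show "continuous_on (cball t (r / norm v)) g"
      using hol sub holomorphic_on_imp_continuous_on holomorphic_on_subset by blast
    show "0 < r / norm v" using r False by simp
    fix s assume "norm (t - s) = r / norm v"
    then show "norm (g s) \<le> M" using sub by (intro gM) (auto simp: dist_norm subset_iff)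
  qed
  \<comment> \<open>The remainder in \<open>complex_Taylor\<close> is divided by
    \<open>fact 1\<close>, not \<open>fact 2\<close>, so the factor 2 from Cauchy's estimate
    survives in the bound.\<close>
  have "norm ((deriv ^^ 0) g 1 - (\<Sum>i\<le>1. (deriv ^^ i) g 0 * (1 - 0) ^ i / (fact i)))
      \<le> fact 2 * M / (r / norm v)^2 * cmod(1 - 0)^(Suc 1) / fact 1"
  proof (rule complex_Taylor[where S="cball 0 1" and f="\<lambda>i. (deriv ^^ i) g"])
    fix i x assume "x \<in> cball (0::complex) 1"
    then have x: "x \<in> ball 0 R" using R2 by (auto simp: R_def)
    have "(deriv ^^ i) g holomorphic_on ball 0 R"
      by (intro holomorphic_higher_deriv hol') simp
    then show "((deriv ^^ i) g has_field_derivative (deriv ^^ Suc i) g x) (at x within cball 0 1)"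
      using x holomorphic_derivI by fastforce
  next
    fix x assume "x \<in> cball (0::complex) 1"
    then show "cmod ((deriv ^^ Suc 1) g x) \<le> fact 2 * M / (r / norm v)^2"
      using d2 by (simp add: numeral_2_eq_2)
  qed auto
  moreover have "deriv g 0 = L v"
    unfolding g_def by (rule DERIV_imp_deriv, rule has_field_derivative_line) (use L in auto)
  ultimately have "norm (g 1 - (g 0 + L v)) \<le> 2 * M / (r / norm v)^2" by simp
  then show ?thesis by (simp add: g_def power_divide algebra_simps)
qed

text \<open>
  A mean over a large circle in the direction of one coordinate only sees \<open>u\<close> far away from \<open>x\<close>,
  so it serves as the Hartogs extension.
\<close>

definition circle_mean :: "'n \<Rightarrow> real \<Rightarrow> (complex ^ 'n \<Rightarrow> 'b::euclidean_space) \<Rightarrow> complex ^ 'n \<Rightarrow> 'b" where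
  "circle_mean a \<rho> u x = integral {0..1} (\<lambda>t. u (x + axis a (circlepath 0 \<rho> t)))"

lemma continuous_on_axis [continuous_intros]:
  fixes f :: "'c::topological_space \<Rightarrow> 'b::real_normed_vector"
  assumes "continuous_on S f" shows "continuous_on S (\<lambda>t. axis a (f t) :: 'b ^ 'n)"
  unfolding axis_def
proof (rule continuous_on_vec_lambda)
  show "continuous_on S (\<lambda>t. if i = a then f t else 0)" for i
    using assms by (cases "i = a") auto
qed

lemma continuous_on_circlepath [continuous_intros]:
  assumes "continuous_on S f" shows "continuous_on S (\<lambda>x. circlepath z \<rho> (f x))"
  unfolding circlepath by (intro continuous_intros assms)

text \<open>Differentiation under the integral sign: the derivative is the mean of the derivatives
  of \<open>u\<close> along the circle. Since \<open>cdiff_on\<close> does not include continuity of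
  the derivative, that continuity is first extracted from the quadratic remainder bound.\<close>

lemma cdiff_on_circle_mean:
  fixes u :: "complex ^ 'n \<Rightarrow> complex"
  assumes u: "cdiff_on u S" "open S"
    and B: "\<And>x t. x \<in> B \<Longrightarrow> t \<in> {0..1} \<Longrightarrow> x + axis a (circlepath 0 \<rho> t) \<in> S"
  shows "cdiff_on (circle_mean a \<rho> u) B"
  unfolding cdiff_on_def
proof
  fix x assume x: "x \<in> B"
  define y where "y t = x + axis a (circlepath 0 \<rho> t)" for t
  have ycont: "continuous_on {0..1} y"
    unfolding y_def by (intro continuous_intros)
  have yS: "y ` {0..1} \<subseteq> S" using B x by (auto simp: y_def)
  obtain r' where r': "r' > 0" "(\<Union>x\<in>y ` {0..1}. cball x r') \<subseteq> S"
    using compact_subset_open_imp_cball_epsilon_subset[OF compact_continuous_image[OF ycont] u(2) yS] by auto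
  \<comment> \<open>A compact neighbourhood of the circle inside \<open>S\<close>, so that one bound
    \<open>M\<close> and one radius serve every \<open>t\<close>.\<close>
  define K where "K = {p + q | p q. p \<in> y ` {0..1} \<and> q \<in> cball 0 r'}"
  have "compact K" unfolding K_def
    by (intro compact_sums compact_continuous_image ycont) auto
  moreover have cK: "cball (y t) r' \<subseteq> K" if "t \<in> {0..1}" for t
  proof
    fix z assume "z \<in> cball (y t) r'"
    then have "z = y t + (z - y t)" "z - y t \<in> cball 0 r'" by (auto simp: dist_norm norm_minus_commute)
    then show "z \<in> K" unfolding K_def using that by blast
  qed
  moreover have KS: "K \<subseteq> S"
  proof
    fix z assume "z \<in> K"
    then obtain t q where "t \<in> {0..1}" "q \<in> cball 0 r'" "z = y t + q" unfolding K_def by blast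
    then have "z \<in> cball (y t) r'" by (simp add: dist_norm)
    then show "z \<in> S" using r' \<open>t \<in> {0..1}\<close> by blast
  qed
  ultimately have "compact (u ` K)"
    using compact_continuous_image cdiff_on_imp_continuous_on[OF u(1)] continuous_on_subset by blast
  then obtain M where M: "\<And>z. z \<in> K \<Longrightarrow> norm (u z) \<le> M"
    using compact_imp_bounded bounded_iff by (metis image_eqI)
  define r where "r = r' / 2"
  have r: "r > 0" "2 * r = r'" using r' by (auto simp: r_def)
  have "\<forall>t\<in>{0..1}. \<exists>L. linear L \<and> (\<forall>(c::complex) v. L (c *s v) = c * L v) \<and> (u has_derivative L) (at (y t))"
    using u(1) yS unfolding cdiff_on_def by blast
  then obtain D where D: "\<And>t. t \<in> {0..1} \<Longrightarrow> linear (D t)"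
    "\<And>t (c::complex) v. t \<in> {0..1} \<Longrightarrow> D t (c *s v) = c * D t v"
    "\<And>t. t \<in> {0..1} \<Longrightarrow> (u has_derivative D t) (at (y t))" by metis
  define C where "C = 2 * M / r\<^sup>2"
  have rem: "norm (u (y t + v) - u (y t) - D t v) \<le> C * (norm v)\<^sup>2"
    if "t \<in> {0..1}" "norm v \<le> r" for t v
    unfolding C_def
  proof (rule cdiff_on_quadratic_remainder[OF u(1) r(1)])
    show "cball (y t) (2 * r) \<subseteq> S" using cK KS that r by auto
    show "norm (u z) \<le> M" if "z \<in> cball (y t) (2 * r)" for z
      using cK[OF \<open>t \<in> {0..1}\<close>] M that r by blast
  qed (use D that in auto)
  have ucont: "continuous_on {0..1} (\<lambda>t. u (y t + v))" if "norm v \<le> r" for v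
  proof (rule continuous_on_compose2[OF cdiff_on_imp_continuous_on[OF u(1)]])
    show "continuous_on {0..1} (\<lambda>t. y t + v)" by (intro continuous_intros ycont)
    show "(\<lambda>t. y t + v) ` {0..1} \<subseteq> S"
      using KS cK that r by (fastforce simp: dist_norm)
  qed
  have Dcont: "continuous_on {0..1} (\<lambda>t. D t v)" for v
  proof -
    \<comment> \<open>Difference quotients with step \<open>1 / Suc k\<close> are continuous in
      \<open>t\<close> for large \<open>k\<close>, and their distance from \<open>D t v\<close> is
      at most \<open>C * (norm v)\<^sup>2 / Suc k\<close>, uniformly in \<open>t\<close>.\<close>
    have lim: "uniform_limit {0..1} (\<lambda>k t. of_nat (Suc k) * (u (y t + (1 / of_nat (Suc k)) *s v) - u (y t)))
        (\<lambda>t. D t v) sequentially"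
    proof (rule uniform_limitI)
      fix e :: real assume e: "e > 0"
      have "(\<lambda>k. norm v / real (Suc k)) \<longlonglongrightarrow> 0" "(\<lambda>k. C * (norm v)\<^sup>2 / real (Suc k)) \<longlonglongrightarrow> 0"
        by (intro real_tendsto_divide_at_top[OF tendsto_const] filterlim_compose[OF filterlim_real_sequentially] filterlim_Suc)+
      then have "\<forall>\<^sub>F k in sequentially. norm v / real (Suc k) < r" "\<forall>\<^sub>F k in sequentially. C * (norm v)\<^sup>2 / real (Suc k) < e"
        using r e by (auto intro: order_tendstoD)
      then show "\<forall>\<^sub>F k in sequentially. \<forall>t\<in>{0..1}. dist (of_nat (Suc k) * (u (y t + (1 / of_nat (Suc k)) *s v) - u (y t))) (D t v) < e"
      proof eventually_elim
        case (elim k)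
        define s where "s = real (Suc k)"
        have s: "s > 0" "of_nat (Suc k) = complex_of_real s" by (auto simp: s_def)
        show ?case
        proof
          fix t :: real assume t: "t \<in> {0..1}"
          let ?w = "(1 / complex_of_real s) *s v"
          have nw: "norm ?w = norm v / s" using s by (simp add: norm_vector_scalar_mult norm_divide)
          have "norm (u (y t + ?w) - u (y t) - D t ?w) \<le> C * (norm v / s)\<^sup>2"
            using rem[OF t, of ?w] elim(1) nw by (simp add: s_def)
          then have "s * norm (u (y t + ?w) - u (y t) - D t ?w) \<le> s * (C * (norm v / s)\<^sup>2)"
            using s by (simp add: mult_left_mono)
          also have "\<dots> = C * (norm v)\<^sup>2 / s" using s by (simp add: field_simps power2_eq_square)
          also have "s * norm (u (y t + ?w) - u (y t) - D t ?w) = norm (of_real s * (u (y t + ?w) - u (y t) - D t ?w))"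
            using s by (simp add: norm_mult)
          also have "of_real s * (u (y t + ?w) - u (y t) - D t ?w) = of_real s * (u (y t + ?w) - u (y t)) - D t v"
            using s D(2)[OF t] by (simp add: algebra_simps)
          finally show "dist (of_nat (Suc k) * (u (y t + (1 / of_nat (Suc k)) *s v) - u (y t))) (D t v) < e"
            using elim(2) unfolding s(2) dist_norm s_def[symmetric] by (rule le_less_trans)
        qed
      qed
    qed
    have "\<forall>\<^sub>F k in sequentially. continuous_on {0..1} (\<lambda>t. of_nat (Suc k) * (u (y t + (1 / of_nat (Suc k)) *s v) - u (y t)))"
    proof -
      have "(\<lambda>k. norm v / real (Suc k)) \<longlonglongrightarrow> 0" 
        by (intro real_tendsto_divide_at_top[OF tendsto_const] filterlim_compose[OF filterlim_real_sequentially] filterlim_Suc)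
      then have "\<forall>\<^sub>F k in sequentially. norm v / real (Suc k) < r"
        using r by (auto intro: order_tendstoD)
      then show ?thesis
      proof eventually_elim
        case (elim k)
        have "norm ((1 / of_nat (Suc k)) *s v) \<le> r"
          using elim by (simp only: norm_vector_scalar_mult norm_divide norm_of_nat norm_one) simp
        then show ?case using ucont[of "(1 / of_nat (Suc k)) *s v"] ucont[of 0] r
          by (intro continuous_intros) auto
      qed
    qed
    then show ?thesis using uniform_limit_theorem[OF _ lim] by simp
  qed
  define L where "L v = integral {0..1} (\<lambda>t. D t v)" for v
  have Dint: "(\<lambda>t. D t v) integrable_on {0..1}" for v
    using integrable_continuous_interval[OF Dcont] by blast
  have "linear L"
  proof (rule linearI)
    show "L (v + w) = L v + L w" for v w
      unfolding L_def integral_add[OF Dint Dint, symmetric]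
      by (rule integral_cong) (simp add: D(1) linear_add)
    show "L (c *\<^sub>R v) = c *\<^sub>R L v" for c v
      unfolding L_def integral_cmul[symmetric]
      by (rule integral_cong) (simp add: D(1) linear_cmul)
  qed
  moreover have "L (c *s v) = c * L v" for c v
  proof -
    have "L (c *s v) = integral {0..1} (\<lambda>t. c * D t v)" unfolding L_def
      by (rule integral_cong) (simp add: D(2))
    then show ?thesis by (simp add: L_def)
  qed
  \<comment> \<open>Integrating the remainder bound over an interval of length 1 keeps the constant
    \<open>C\<close>, so the relative error is at most \<open>C * norm (z - x)\<close>.\<close>
  moreover have "(circle_mean a \<rho> u has_derivative L) (at x)"
  proof (rule has_derivativeI_sandwich[where e=r and H="\<lambda>z. C * norm (z - x)"])
    show "bounded_linear L" using \<open>linear L\<close> by (simp add: linear_conv_bounded_linear)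
    show "((\<lambda>z. C * norm (z - x)) \<longlongrightarrow> 0) (at x)"
      by (auto intro!: tendsto_eq_intros)
    fix z assume z: "z \<noteq> x" "dist z x < r"
    define v where "v = z - x"
    have v: "norm v \<le> r" "v \<noteq> 0" using z by (auto simp: v_def dist_norm)
    have ui: "(\<lambda>t. u (y t + v)) integrable_on {0..1}" "(\<lambda>t. u (y t)) integrable_on {0..1}"
      using ucont[of v] ucont[of 0] v r by (auto intro: integrable_continuous_interval)
    have "circle_mean a \<rho> u z = integral {0..1} (\<lambda>t. u (y t + v))"
      unfolding circle_mean_def y_def v_def by (simp add: algebra_simps)
    moreover have "circle_mean a \<rho> u x = integral {0..1} (\<lambda>t. u (y t))"
      unfolding circle_mean_def y_def by simp
    ultimately have "circle_mean a \<rho> u z - circle_mean a \<rho> u x - L v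
        = integral {0..1} (\<lambda>t. u (y t + v) - u (y t) - D t v)"
      using ui Dint by (simp add: L_def integral_diff integrable_diff)
    also have "norm \<dots> \<le> (C * (norm v)\<^sup>2) * (1 - 0)"
    proof (rule integral_bound)
      show "continuous_on {0..1} (\<lambda>t. u (y t + v) - u (y t) - D t v)"
        using ucont[of v] ucont[of 0] v r by (intro continuous_intros Dcont) auto
    qed (use rem v in auto)
    finally show "norm (circle_mean a \<rho> u z - circle_mean a \<rho> u x - L (z - x)) / norm (z - x) \<le> C * norm (z - x)"
      using v unfolding v_def[symmetric] by (simp add: field_simps power2_eq_square)
  qed (use r in auto)
  ultimately show "\<exists>L. linear L \<and> (\<forall>(c::complex) v. L (c *s v) = c * L v) \<and> (circle_mean a \<rho> u has_derivative L) (at x)"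
    by blast
qed

text \<open>The mean value property on the complex line through \<open>x\<close> in direction
  \<open>a\<close>. In Cauchy's formula at the centre, the derivative of the circle cancels the
  kernel \<open>1 / w\<close> up to the factor \<open>2 * pi * \<i>\<close>.\<close>

lemma circle_mean_eq:
  fixes u :: "complex ^ 'n \<Rightarrow> complex"
  assumes u: "cdiff_on u S" and x: "\<And>z. x + axis a z \<in> S" and "\<rho> > 0"
  shows "circle_mean a \<rho> u x = u x"
proof -
  have ax: "axis a z = z *s axis a 1" for z :: complex by (simp add: vec_eq_iff axis_def)
  define g where "g z = u (x + axis a z)" for z
  have "g holomorphic_on cball 0 \<rho>"
    unfolding g_def using cdiff_on_imp_holomorphic_on_line[OF u, of "cball 0 \<rho>" x "axis a 1"] x
    by (simp flip: ax)
  from Cauchy_integral_circlepath_simple[OF this, of 0] \<open>\<rho> > 0\<close>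
  have "((\<lambda>w. g w / w) has_contour_integral 2 * of_real pi * \<i> * g 0) (circlepath 0 \<rho>)" by simp
  then have "((\<lambda>t. g (circlepath 0 \<rho> t) / circlepath 0 \<rho> t *
       vector_derivative (circlepath 0 \<rho>) (at t within {0..1})) has_integral 2 * of_real pi * \<i> * g 0) {0..1}"
    unfolding has_contour_integral_def .
  then have "((\<lambda>t. (2 * of_real pi * \<i>) * g (circlepath 0 \<rho> t)) has_integral 2 * of_real pi * \<i> * g 0) {0..1}"
    by (rule has_integral_eq[rotated])
       (use \<open>\<rho> > 0\<close> in \<open>simp add: vector_derivative_circlepath01, simp add: circlepath\<close>)
  from has_integral_mult_right[OF this, of "1 / (2 * of_real pi * \<i>)"]
  have "((\<lambda>t. g (circlepath 0 \<rho> t)) has_integral g 0) {0..1}" by simp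
  then show ?thesis
    unfolding circle_mean_def g_def by (simp add: integral_unique axis_def flip: zero_vec_def)
qed

text \<open>The one-variable identity theorem on the complex line through \<open>x\<close> and
  \<open>y\<close>. The part of that line inside \<open>S\<close> may be disconnected, so the
  argument is confined to the component of the parameter 0, which also contains 1 because the real
  segment lies in \<open>S\<close>.\<close>

lemma cdiff_on_eq_along_segment:
  fixes u :: "complex ^ 'n \<Rightarrow> complex"
  assumes u: "cdiff_on u S" "cdiff_on w S" "open S" and seg: "closed_segment x y \<subseteq> S"
    and U: "open U" "x \<in> U" "\<And>z. z \<in> U \<inter> S \<Longrightarrow> u z = w z"
  shows "u y = w y"
proof -
  define l where "l t = x + t *s (y - x)" for t :: complex
  have contl: "continuous_on UNIV l" unfolding l_def
    by (intro continuous_intros bounded_linear.continuous_on[OF bounded_linear_scalar_mult_left])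
  define T where "T = l -` S"
  have oT: "open T" unfolding T_def using contl u(3) open_vimage by blast
  define V where "V = connected_component_set T 0"
  have segT: "closed_segment 0 1 \<subseteq> T"
  proof
    fix t :: complex assume "t \<in> closed_segment 0 1"
    then obtain s where s: "0 \<le> s" "s \<le> 1" "t = of_real s" by (auto simp: in_segment scaleR_conv_of_real)
    have "l t = (1 - s) *\<^sub>R x + s *\<^sub>R y"
      unfolding l_def s(3) by (simp add: vec_eq_iff, simp add: scaleR_conv_of_real algebra_simps)
    then have "l t \<in> closed_segment x y" using s by (auto simp: in_segment)
    then show "t \<in> T" unfolding T_def using seg by auto
  qed
  have V: "open V" "connected V" "0 \<in> V" "1 \<in> V" "V \<subseteq> T"
  proof -
    show "open V" "connected V" "V \<subseteq> T" unfolding V_def using oT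
      by (auto simp: open_connected_component connected_component_subset)
    have "closed_segment 0 1 \<subseteq> V" unfolding V_def
      by (intro connected_component_maximal segT) auto
    then show "0 \<in> V" "1 \<in> V" by auto
  qed
  have "u (l 1) = w (l 1)"
  proof (rule analytic_continuation_open[where s="V \<inter> l -` U" and s'=V and f="\<lambda>t. u (l t)" and g="\<lambda>t. w (l t)"])
    show "open (V \<inter> l -` U)" using V U contl open_vimage by blast
    show "V \<inter> l -` U \<noteq> {}" using V U by (auto simp: l_def)
    show "(\<lambda>t. u (l t)) holomorphic_on V" "(\<lambda>t. w (l t)) holomorphic_on V"
      unfolding l_def using V(5)
      by (intro cdiff_on_imp_holomorphic_on_line[OF u(1)] cdiff_on_imp_holomorphic_on_line[OF u(2)];
          auto simp: T_def l_def)+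
    show "u (l z) = w (l z)" if "z \<in> V \<inter> l -` U" for z
      using that V(5) U by (auto simp: T_def)
  qed (use V in auto)
  then show ?thesis by (simp add: l_def)
qed

section \<open>Calculus of holomorphic maps\<close>

lemma cdiff_on_cong:
  assumes "cdiff_on u S" "open S" "\<And>x. x \<in> S \<Longrightarrow> w x = u x"
  shows "cdiff_on w S"
  unfolding cdiff_on_def
proof
  fix x assume x: "x \<in> S"
  then obtain L where "linear L" "\<forall>(c::complex) v. L (c *s v) = c * L v" "(u has_derivative L) (at x)"
    using assms(1) unfolding cdiff_on_def by blast
  then show "\<exists>L. linear L \<and> (\<forall>(c::complex) v. L (c *s v) = c * L v) \<and> (w has_derivative L) (at x)"
    using has_derivative_transform_within_open[of u L x UNIV S w] assms(2,3) x by metis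
qed

lemma holo_on_cong:
  "holo_on f S \<Longrightarrow> open S \<Longrightarrow> (\<And>x. x \<in> S \<Longrightarrow> g x = f x) \<Longrightarrow> holo_on g S"
  unfolding holo_on_iff_components by (auto intro: cdiff_on_cong)

lemma holo_on_subset: "holo_on f S \<Longrightarrow> T \<subseteq> S \<Longrightarrow> holo_on f T"
  unfolding holo_on_def by blast

lemma holo_on_imp_continuous_on: "holo_on f S \<Longrightarrow> continuous_on S f"
  unfolding holo_on_def by (meson has_derivative_continuous continuous_at_imp_continuous_on)

lemma holo_on_ident: "holo_on (\<lambda>x. x) S"
  unfolding holo_on_def by (intro ballI exI[of _ "\<lambda>x. x"]) (auto simp: linear_iff)

lemma holo_on_compose:
  assumes f: "holo_on f S" and g: "holo_on g T" and sub: "\<And>x. x \<in> S \<Longrightarrow> f x \<in> T"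
  shows "holo_on (g \<circ> f) S"
  unfolding holo_on_def
proof
  fix x assume x: "x \<in> S"
  obtain L where L: "linear L" "\<forall>(c::complex) v. L (c *s v) = c *s L v" "(f has_derivative L) (at x)"
    using f x unfolding holo_on_def by blast
  obtain M where M: "linear M" "\<forall>(c::complex) v. M (c *s v) = c *s M v" "(g has_derivative M) (at (f x))"
    using g sub[OF x] unfolding holo_on_def by blast
  show "\<exists>L. linear L \<and> (\<forall>(c::complex) v. L (c *s v) = c *s L v) \<and> (g \<circ> f has_derivative L) (at x)"
    using L M has_derivative_compose[OF L(3) M(3)]
    by (intro exI[of _ "M \<circ> L"]) (auto simp: o_def dest: has_derivative_linear)
qed

lemma norm_axis: "norm (axis a z :: 'b::real_normed_vector ^ 'n) = norm z"
  by (simp add: norm_vec_def L2_set_def axis_def if_distrib[of norm] if_distrib[of "\<lambda>x. x\<^sup>2"] cong: if_cong)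

section \<open>Hartogs extension from the cones\<close>

text \<open>With the block of coordinates as a parameter, both domains are instances:
  \<open>hcone (-P)\<close> is the cone on which the form belonging to \<open>P\<close> is negative.
  Every result then applies to both sides.\<close>

definition hcone :: "'n set \<Rightarrow> (complex ^ 'n) set" where
  "hcone P = {x. (\<Sum>i\<in>-P. (norm (x $ i))\<^sup>2) < (\<Sum>i\<in>P. (norm (x $ i))\<^sup>2)}"

lemma open_hcone [simp]: "open (hcone P)"
  unfolding hcone_def by (intro open_Collect_less continuous_intros)

lemma sum_norm_sq_le: "(\<Sum>i\<in>A. (norm (x $ i))\<^sup>2) \<le> (norm (x :: complex ^ 'n))\<^sup>2"
proof -
  have "(norm x)\<^sup>2 = (\<Sum>i\<in>UNIV. (norm (x $ i))\<^sup>2)"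
    by (simp add: norm_vec_def L2_set_def sum_nonneg)
  then show ?thesis by (simp add: sum_mono2)
qed

lemma hconeI:
  fixes x :: "complex ^ 'n"
  assumes "a \<in> P" "(\<Sum>i\<in>-P. (norm (x $ i))\<^sup>2) < (norm (x $ a))\<^sup>2"
  shows "x \<in> hcone P"
  using assms member_le_sum[of a P "\<lambda>i. (norm (x $ i))\<^sup>2"]
  by (simp add: hcone_def)

lemma sum_add_axis:
  fixes x :: "complex ^ 'n"
  assumes "a \<in> P"
  shows "(\<Sum>i\<in>-P. (norm ((x + axis a z) $ i))\<^sup>2) = (\<Sum>i\<in>-P. (norm (x $ i))\<^sup>2)"
  by (rule sum.cong) (use assms in \<open>auto simp: axis_def\<close>)

text \<open>On a circle of radius above \<open>2 * norm x\<close>, coordinate \<open>a\<close> alone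
  exceeds \<open>norm x\<close> in modulus and so outweighs all coordinates outside
  \<open>P\<close>. The point \<open>x\<close> itself need not lie in the cone.\<close>

lemma circle_in_hcone:
  fixes x :: "complex ^ 'n"
  assumes "a \<in> P" "2 * norm x < \<rho>"
  shows "x + axis a (circlepath 0 \<rho> t) \<in> hcone P"
proof (rule hconeI[OF assms(1)])
  have \<rho>: "\<rho> > 0" using assms(2) norm_ge_zero[of x] by linarith
  have "norm (circlepath 0 \<rho> t) = \<rho>" using \<rho> by (simp add: circlepath norm_mult)
  then have "\<rho> \<le> norm (x $ a + circlepath 0 \<rho> t) + norm (x $ a)"
    by (metis add_diff_cancel_left' norm_triangle_ineq4)
  moreover have "norm (x $ a) \<le> norm x" by (rule Finite_Cartesian_Product.norm_nth_le)
  ultimately have "norm x < norm (x $ a + circlepath 0 \<rho> t)" using assms(2) by linarith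
  then have "(norm x)\<^sup>2 < (norm (x $ a + circlepath 0 \<rho> t))\<^sup>2" by (simp add: power_strict_mono)
  with sum_norm_sq_le[of x "-P"]
  show "(\<Sum>i\<in>-P. (norm ((x + axis a (circlepath 0 \<rho> t)) $ i))\<^sup>2) < (norm ((x + axis a (circlepath 0 \<rho> t)) $ a))\<^sup>2"
    unfolding sum_add_axis[OF assms(1)] by simp
qed

lemma axis_in_hcone: "a \<in> P \<Longrightarrow> z \<noteq> 0 \<Longrightarrow> axis a z \<in> hcone P"
  using sum_add_axis[of a P 0 z] by (intro hconeI[of a]) auto

text \<open>Two coordinates in \<open>P\<close> share the work. Circles in direction
  \<open>a\<close> define the extension everywhere, while on the region \<open>U\<close>, where
  coordinate \<open>b\<close> alone dominates, whole lines in direction \<open>a\<close> stay in the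
  cone and the mean reproduces \<open>u\<close>. The identity theorem carries the agreement from
  \<open>U\<close> to the whole cone.\<close>

lemma cdiff_on_hcone_extends:
  fixes u :: "complex ^ 'n \<Rightarrow> complex"
  assumes u: "cdiff_on u (hcone P)" and ab: "a \<in> P" "b \<in> P" "a \<noteq> b"
  shows "\<exists>F. cdiff_on F UNIV \<and> (\<forall>x\<in>hcone P. F x = u x)"
proof -
  define U where "U = {x :: complex ^ 'n. (\<Sum>i\<in>-P. (norm (x $ i))\<^sup>2) < (norm (x $ b))\<^sup>2}"
  define F where "F x = circle_mean a (2 * norm x + 1) u x" for x
  have oU: "open U" unfolding U_def by (intro open_Collect_less continuous_intros)
  have "U \<subseteq> hcone P" unfolding U_def using hconeI[OF ab(2)] by auto
  moreover have "x + axis a z \<in> U" if "x \<in> U" for x z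
    using that ab unfolding U_def mem_Collect_eq sum_add_axis[OF ab(1)] by (simp add: axis_def)
  ultimately have meanU: "circle_mean a \<rho> u x = u x" if "x \<in> U" "\<rho> > 0" for x \<rho>
    using that by (intro circle_mean_eq[OF u]) auto
  have cd: "cdiff_on (circle_mean a \<rho> u) (ball 0 (\<rho> / 2))" for \<rho>
    by (rule cdiff_on_circle_mean[OF u open_hcone circle_in_hcone[OF ab(1)]]) auto
  \<comment> \<open>Both means are holomorphic on the ball of radius \<open>m\<close>. They agree
    with \<open>u\<close> on the part of \<open>U\<close> in this ball, hence near the point
    \<open>y\<close> on the \<open>b\<close> axis, and therefore along the segment from
    \<open>y\<close> to \<open>x\<close>.\<close>
  have indep: "circle_mean a \<rho> u x = circle_mean a \<rho>' u x"
    if "2 * norm x < \<rho>" "2 * norm x < \<rho>'" for \<rho> \<rho>' x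
  proof -
    define m where "m = min \<rho> \<rho>' / 2"
    have m: "norm x < m" "m \<le> \<rho> / 2" "m \<le> \<rho>' / 2" using that by (auto simp: m_def)
    then have "m > 0" using norm_ge_zero[of x] by linarith
    define y :: "complex ^ 'n" where "y = axis b (of_real (m / 2))"
    have "norm y < m" using \<open>m > 0\<close> by (simp add: y_def norm_axis)
    then have "y \<in> ball 0 m" "x \<in> ball 0 m" using m by auto
    then have seg: "closed_segment y x \<subseteq> ball 0 m"
      using closed_segment_subset convex_ball by blast
    have yU: "y \<in> U"
    proof -
      have "(\<Sum>i\<in>-P. (norm (y $ i))\<^sup>2) = 0" using ab by (intro sum.neutral) (auto simp: y_def axis_def)
      then show ?thesis using \<open>m > 0\<close> by (simp add: U_def y_def axis_def)
    qed
    show ?thesis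
    proof (rule cdiff_on_eq_along_segment[OF _ _ open_ball seg oU yU])
      show "cdiff_on (circle_mean a \<rho> u) (ball 0 m)" "cdiff_on (circle_mean a \<rho>' u) (ball 0 m)"
        using cd m by (meson cdiff_on_subset subset_ball)+
      show "circle_mean a \<rho> u z = circle_mean a \<rho>' u z" if "z \<in> U \<inter> ball 0 m" for z
        using that meanU m \<open>m > 0\<close> by simp
    qed
  qed
  \<comment> \<open>The radius in \<open>F\<close> varies with the point, but by
    \<open>indep\<close> it can be replaced by a fixed one on each ball.\<close>
  have "cdiff_on F (ball 0 (\<rho> / 2))" for \<rho>
    by (rule cdiff_on_cong[OF cd open_ball]) (auto simp: F_def intro!: indep)
  moreover have "x \<in> ball 0 ((2 * norm x + 1) / 2)" for x :: "complex ^ 'n" by simp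
  ultimately have F: "cdiff_on F UNIV" unfolding cdiff_on_def by blast
  moreover have "F x = u x" if x: "x \<in> hcone P" for x
  proof -
    \<comment> \<open>The phase of \<open>x $ b\<close>, or 1 if that coordinate vanishes: moving in
      this direction increases the modulus of coordinate \<open>b\<close>, so the path never leaves
      the cone.\<close>
    define q where "q = (if x $ b = 0 then 1 else sgn (x $ b))"
    have q: "norm q = 1" "x $ b = of_real (norm (x $ b)) * q"
      by (auto simp: q_def sgn_eq norm_divide)
    \<comment> \<open>Far enough that coordinate \<open>b\<close> of \<open>y\<close> exceeds
      \<open>norm x\<close> in modulus, which puts \<open>y\<close> into \<open>U\<close>.\<close>
    define M where "M = norm x + 1"
    have "M > 0" using norm_ge_zero[of x] by (simp add: M_def add_nonneg_pos)
    define y where "y = x + axis b (of_real M * q)"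
    have nb: "norm ((x + axis b (of_real s * q)) $ b) = norm (x $ b) + s" if "s \<ge> 0" for s
    proof -
      have "(x + axis b (of_real s * q)) $ b = of_real (norm (x $ b) + s) * q"
        using q(2) by (simp add: algebra_simps)
      also have "norm \<dots> = norm (x $ b) + s" using that q(1) by (simp only: norm_mult norm_of_real) simp
      finally show ?thesis .
    qed
    have seg: "closed_segment y x \<subseteq> hcone P"
    proof
      fix z assume "z \<in> closed_segment y x"
      then obtain s where s: "0 \<le> s" "s \<le> 1" "z = (1 - s) *\<^sub>R y + s *\<^sub>R x" by (auto simp: in_segment)
      define s' where "s' = (1 - s) * M"
      have "s' \<ge> 0" using s \<open>M > 0\<close> by (simp add: s'_def)
      have z: "z = x + axis b (of_real s' * q)"
        unfolding s(3) y_def s'_def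
        by (simp add: vec_eq_iff axis_def, simp add: scaleR_conv_of_real algebra_simps)
      have "(\<Sum>i\<in>-P. (norm (z $ i))\<^sup>2) = (\<Sum>i\<in>-P. (norm (x $ i))\<^sup>2)"
        unfolding z by (rule sum_add_axis[OF ab(2)])
      also have "\<dots> < (\<Sum>i\<in>P. (norm (x $ i))\<^sup>2)" using x by (simp add: hcone_def)
      also have "\<dots> \<le> (\<Sum>i\<in>P. (norm (z $ i))\<^sup>2)"
      proof (intro sum_mono power_mono)
        fix i show "norm (x $ i) \<le> norm (z $ i)"
        proof (cases "i = b")
          case True then show ?thesis using nb[OF \<open>s' \<ge> 0\<close>] \<open>s' \<ge> 0\<close> z by simp
        next
          case False then show ?thesis by (simp add: z axis_def)
        qed
      qed auto
      finally show "z \<in> hcone P" by (simp add: hcone_def)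
    qed
    have yU: "y \<in> U"
    proof -
      have "(\<Sum>i\<in>-P. (norm (y $ i))\<^sup>2) = (\<Sum>i\<in>-P. (norm (x $ i))\<^sup>2)"
        unfolding y_def by (rule sum_add_axis[OF ab(2)])
      also have "\<dots> \<le> (norm x)\<^sup>2" by (rule sum_norm_sq_le)
      also have "\<dots> < (norm (x $ b) + M)\<^sup>2"
        using norm_ge_zero[of "x $ b"] by (intro power_strict_mono) (auto simp: M_def add_nonneg_pos)
      also have "norm (x $ b) + M = norm (y $ b)" using nb[of M] \<open>M > 0\<close> y_def by simp
      finally show ?thesis by (simp add: U_def)
    qed
    show ?thesis
    proof (rule cdiff_on_eq_along_segment[OF _ u open_hcone seg oU yU])
      show "F z = u z" if "z \<in> U \<inter> hcone P" for z
        using that meanU unfolding F_def by (simp add: add_nonneg_pos)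
    qed (use F cdiff_on_subset in blast)
  qed
  ultimately show ?thesis by blast
qed

lemma two_le_cardE:
  assumes "2 \<le> card P"
  obtains a b where "a \<in> P" "b \<in> P" "a \<noteq> b"
  using assms by (meson card_2_iff' ex_card subsetD)

lemma holo_on_hcone_extends:
  fixes f :: "complex ^ 'n \<Rightarrow> complex ^ 'm"
  assumes "2 \<le> card P" "holo_on f (hcone P)"
  shows "\<exists>F. holo_on F UNIV \<and> (\<forall>x\<in>hcone P. F x = f x)"
proof -
  obtain a b where ab: "a \<in> P" "b \<in> P" "a \<noteq> b" using two_le_cardE[OF assms(1)] .
  have "\<forall>i. \<exists>F. cdiff_on F UNIV \<and> (\<forall>x\<in>hcone P. F x = f x $ i)"
    using cdiff_on_hcone_extends[OF _ ab] assms(2) holo_on_iff_components by blast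
  then obtain F where F: "\<And>i. cdiff_on (F i) UNIV" "\<And>i x. x \<in> hcone P \<Longrightarrow> F i x = f x $ i" by metis
  show ?thesis
    by (rule exI[of _ "\<lambda>x. \<chi> i. F i x"]) (simp add: holo_on_iff_components F vec_eq_iff)
qed

section \<open>Entire maps determined by their values on a cone\<close>

lemma entire_eqI:
  fixes F G :: "complex ^ 'n \<Rightarrow> complex ^ 'm"
  assumes "P \<noteq> {}" "holo_on F UNIV" "holo_on G UNIV" "\<And>x. x \<in> hcone P \<Longrightarrow> F x = G x"
  shows "F = G"
proof
  fix x
  obtain a where "a \<in> P" using assms(1) by blast
  then have "(axis a 1 :: complex ^ 'n) \<in> hcone P" by (simp add: axis_in_hcone)
  then have "F x $ i = G x $ i" for i
    using assms by (intro cdiff_on_eq_along_segment[of "\<lambda>x. F x $ i" UNIV "\<lambda>x. G x $ i" "axis a 1" x "hcone P"])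
      (auto simp: holo_on_iff_components)
  then show "F x = G x" by (simp add: vec_eq_iff)
qed

text \<open>Recovers an entire extension from values in the cone by an explicit integral. This is
  what makes extension continuous for locally uniform convergence.\<close>

lemma entire_eq_circle_mean:
  fixes F :: "complex ^ 'n \<Rightarrow> complex ^ 'm"
  assumes F: "holo_on F UNIV" "\<And>x. x \<in> hcone P \<Longrightarrow> F x = f x" and a: "a \<in> P" "2 * norm x < \<rho>"
  shows "F x = circle_mean a \<rho> f x"
proof -
  have "\<rho> > 0" using a(2) norm_ge_zero[of x] by linarith
  have "circle_mean a \<rho> f x = circle_mean a \<rho> F x"
    unfolding circle_mean_def by (simp add: F(2) circle_in_hcone[OF a])
  moreover have "circle_mean a \<rho> F x $ i = F x $ i" for i
  proof -
    have "continuous_on {0..1} (\<lambda>t. F (x + axis a (circlepath 0 \<rho> t)))"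
      by (intro continuous_on_compose2[OF holo_on_imp_continuous_on[OF F(1)]] continuous_intros) auto
    then have "circle_mean a \<rho> F x $ i = circle_mean a \<rho> (\<lambda>x. F x $ i) x"
      unfolding circle_mean_def
      using integral_linear[OF integrable_continuous_interval bounded_linear_vec_nth[of i],
          of 0 1 "\<lambda>t. F (x + axis a (circlepath 0 \<rho> t))"]
      by (simp add: o_def)
    also have "\<dots> = F x $ i"
      using F(1) \<open>\<rho> > 0\<close> by (intro circle_mean_eq[of _ UNIV]) (auto simp: holo_on_iff_components)
    finally show ?thesis .
  qed
  ultimately show ?thesis by (simp add: vec_eq_iff)
qed

text \<open>For nonempty \<open>P\<close> there is at most one such extension, so the choice is
  canonical whenever an extension exists.\<close>

definition entire_ext :: "'n set \<Rightarrow> (complex ^ 'n \<Rightarrow> complex ^ 'm) \<Rightarrow> complex ^ 'n \<Rightarrow> complex ^ 'm" where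
  "entire_ext P f = (SOME F. holo_on F UNIV \<and> (\<forall>x\<in>hcone P. F x = f x))"

lemma entire_ext:
  assumes "2 \<le> card P" "holo_on f (hcone P)"
  shows "holo_on (entire_ext P f) UNIV" "\<And>x. x \<in> hcone P \<Longrightarrow> entire_ext P f x = f x"
  using someI_ex[OF holo_on_hcone_extends[OF assms]] unfolding entire_ext_def by blast+

lemma entire_ext_unique:
  assumes "P \<noteq> {}" "holo_on F UNIV" "\<And>x. x \<in> hcone P \<Longrightarrow> F x = f x"
  shows "entire_ext P f = F"
proof -
  have "holo_on (entire_ext P f) UNIV \<and> (\<forall>x\<in>hcone P. entire_ext P f x = f x)"
    unfolding entire_ext_def by (rule someI[of _ F]) (use assms in auto)
  then show ?thesis using assms by (intro entire_eqI[OF assms(1)]) auto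
qed

text \<open>Off the cone the block \<open>P\<close> has at most the weight of the other block.
  Equality at a point of an open set is impossible, since a small move in a coordinate from
  \<open>P\<close> would tip the balance into \<open>hcone P\<close>.\<close>

lemma interior_compl_hcone:
  fixes P :: "'n::finite set"
  assumes "P \<noteq> {}" "open W" "W \<inter> hcone P = {}"
  shows "W \<subseteq> hcone (-P)"
proof
  fix x assume xW: "x \<in> W"
  let ?p = "\<lambda>x::complex^'n. \<Sum>i\<in>P. (norm (x $ i))\<^sup>2" and ?n = "\<lambda>x::complex^'n. \<Sum>i\<in>-P. (norm (x $ i))\<^sup>2"
  have le: "?p x \<le> ?n x" if "x \<in> W" for x using assms(3) that by (auto simp: hcone_def)
  have "?p x \<noteq> ?n x"
  proof
    assume eq: "?p x = ?n x"
    obtain a where a: "a \<in> P" using assms(1) by blast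
    obtain e where e: "e > 0" "ball x e \<subseteq> W" using assms(2) xW open_contains_ball by blast
    \<comment> \<open>The sign follows the real part of \<open>x $ a\<close>, so that adding
      \<open>t\<close> strictly increases the modulus.\<close>
    define t where "t = (if Re (x $ a) \<ge> 0 then e / 2 else - e / 2)"
    define y where "y = x + axis a (of_real t)"
    have "\<bar>t\<bar> < e" using e by (simp add: t_def)
    then have "y \<in> W" using e(2) by (intro subsetD[OF e(2)]) (simp add: y_def dist_norm norm_axis)
    have t: "t * Re (x $ a) \<ge> 0" "t \<noteq> 0" using e by (auto simp: t_def mult_nonneg_nonpos)
    have "(norm (y $ a))\<^sup>2 = (norm (x $ a))\<^sup>2 + 2 * (t * Re (x $ a)) + t\<^sup>2"
      unfolding cmod_power2 by (simp add: y_def power2_eq_square algebra_simps)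
    moreover have "t\<^sup>2 > 0" using t by simp
    ultimately have gt: "(norm (y $ a))\<^sup>2 > (norm (x $ a))\<^sup>2" using t by linarith
    have "?p x < ?p y"
    proof (rule sum_strict_mono_ex1)
      show "\<forall>i\<in>P. (norm (x $ i))\<^sup>2 \<le> (norm (y $ i))\<^sup>2"
      proof
        fix i show "(norm (x $ i))\<^sup>2 \<le> (norm (y $ i))\<^sup>2"
        proof (cases "i = a")
          case True
          then show ?thesis using gt by (simp only: less_imp_le)
        qed (simp add: y_def axis_def)
      qed
    qed (use gt a in auto)
    moreover have "?n y = ?n x" unfolding y_def by (rule sum_add_axis[OF a])
    ultimately show False using le[OF \<open>y \<in> W\<close>] eq by linarith
  qed
  then show "x \<in> hcone (-P)" using le[OF xW] by (simp add: hcone_def)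
qed

lemma hcone_disjoint: "hcone P \<inter> hcone (-P) = {}"
  by (auto simp: hcone_def)

section \<open>Automorphisms of the two cones\<close>

lemma Aut_imp_inverse:
  assumes "f \<in> Aut D"
  obtains g where "holo_on g D" "\<And>x. x \<in> D \<Longrightarrow> g x \<in> D" "\<And>x. x \<in> D \<Longrightarrow> g (f x) = x"
    "\<And>x. x \<in> D \<Longrightarrow> f (g x) = x"
proof -
  obtain g where g: "holo_on g D" "\<And>x. x \<in> D \<Longrightarrow> g (f x) = x" and im: "f ` D = D"
    using assms unfolding Aut_def biholo_def bij_betw_def by auto
  have "g x \<in> D \<and> f (g x) = x" if "x \<in> D" for x
    using that g(2) im by (metis image_iff)
  then show ?thesis using g that by blast
qed

lemma AutD:
  assumes "f \<in> Aut D"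
  shows "holo_on f D" "x \<in> D \<Longrightarrow> f x \<in> D" "x \<notin> D \<Longrightarrow> f x = x"
  using assms unfolding Aut_def biholo_def by (auto dest: bij_betwE)

lemma Aut_I:
  assumes "holo_on f D" "holo_on g D" "\<And>x. x \<in> D \<Longrightarrow> f x \<in> D" "\<And>x. x \<in> D \<Longrightarrow> g x \<in> D"
    "\<And>x. x \<in> D \<Longrightarrow> g (f x) = x" "\<And>x. x \<in> D \<Longrightarrow> f (g x) = x" "\<And>x. x \<notin> D \<Longrightarrow> f x = x"
  shows "f \<in> Aut D"
proof -
  have "bij_betw f D D" by (rule bij_betw_byWitness[where f'=g]) (use assms in auto)
  then show ?thesis using assms unfolding Aut_def biholo_def by blast
qed

text \<open>The composed extensions agree with the identity on the cone, hence everywhere by the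
  identity theorem.\<close>

lemma entire_ext_inverse:
  fixes P :: "'n::finite set"
  assumes P: "2 \<le> card P"
    and fg: "holo_on f (hcone P)" "holo_on g (hcone P)" "\<And>x. x \<in> hcone P \<Longrightarrow> f x \<in> hcone P"
      "\<And>x. x \<in> hcone P \<Longrightarrow> g (f x) = x"
  shows "entire_ext P g (entire_ext P f x) = x"
proof -
  have "entire_ext P g \<circ> entire_ext P f = (\<lambda>x. x)"
  proof (rule entire_eqI)
    show "P \<noteq> {}" using P by auto
    show "holo_on (entire_ext P g \<circ> entire_ext P f) UNIV"
      by (rule holo_on_compose[where T=UNIV]) (use entire_ext P fg in auto)
    show "(entire_ext P g \<circ> entire_ext P f) x = x" if "x \<in> hcone P" for x
      using that fg(3,4) entire_ext(2)[OF P fg(1)] entire_ext(2)[OF P fg(2)] by simp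
  qed (rule holo_on_ident)
  then show ?thesis by (metis comp_apply)
qed

text \<open>The preimage of the opposite cone under \<open>G\<close> is open and misses
  \<open>hcone P\<close>, because \<open>G\<close> maps \<open>hcone P\<close> into itself; hence it
  lies in the opposite cone. It contains \<open>F x\<close>, as \<open>G (F x) = x\<close>.\<close>

lemma entire_maps_opposite_hcone:
  fixes P :: "'n::finite set"
  assumes "P \<noteq> {}" "continuous_on UNIV G" "\<And>x. G (F x) = x" "\<And>x. F (G x) = x"
    "\<And>x. x \<in> hcone P \<Longrightarrow> G x \<in> hcone P" "x \<in> hcone (-P)"
  shows "F x \<in> hcone (-P)"
proof -
  have "G -` hcone (-P) \<subseteq> hcone (-P)"
  proof (rule interior_compl_hcone[OF assms(1)])
    show "open (G -` hcone (-P))" using assms(2) open_vimage open_hcone by blast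
    show "G -` hcone (-P) \<inter> hcone P = {}" using assms(5) hcone_disjoint[of P] by blast
  qed
  then show ?thesis using assms(3,6) by auto
qed

text \<open>The identity branch follows the normalisation in \<open>Aut\<close>, so that
  \<open>flip P f\<close> can be a member of \<open>Aut (hcone (-P))\<close>.\<close>

definition flip :: "'n set \<Rightarrow> (complex ^ 'n \<Rightarrow> complex ^ 'n) \<Rightarrow> complex ^ 'n \<Rightarrow> complex ^ 'n" where
  "flip P f x = (if x \<in> hcone (-P) then entire_ext P f x else x)"

lemma flip_in_Aut:
  fixes P :: "'n::finite set"
  assumes P: "2 \<le> card P" and f: "f \<in> Aut (hcone P)"
  shows "flip P f \<in> Aut (hcone (-P))"
proof -
  obtain g where g: "holo_on g (hcone P)" "\<And>x. x \<in> hcone P \<Longrightarrow> g x \<in> hcone P"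
    "\<And>x. x \<in> hcone P \<Longrightarrow> g (f x) = x" "\<And>x. x \<in> hcone P \<Longrightarrow> f (g x) = x"
    using Aut_imp_inverse[OF f] by metis
  note f' = AutD[OF f]
  let ?F = "entire_ext P f" and ?G = "entire_ext P g"
  have ne: "P \<noteq> {}" using P by auto
  have GF: "?G (?F x) = x" for x by (rule entire_ext_inverse[OF P]) (use f' g in auto)
  have FG: "?F (?G x) = x" for x by (rule entire_ext_inverse[OF P]) (use f' g in auto)
  have h: "holo_on ?F UNIV" "holo_on ?G UNIV" using entire_ext P f' g by auto
  have c: "continuous_on UNIV ?F" "continuous_on UNIV ?G" using h holo_on_imp_continuous_on by auto
  have F: "?F x \<in> hcone (-P)" if "x \<in> hcone (-P)" for x
    by (rule entire_maps_opposite_hcone[OF ne c(2) GF FG _ that]) (use entire_ext[OF P g(1)] g in auto)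
  have G: "?G x \<in> hcone (-P)" if "x \<in> hcone (-P)" for x
    by (rule entire_maps_opposite_hcone[OF ne c(1) FG GF _ that]) (use entire_ext[OF P f'(1)] f' in auto)
  have "holo_on ?F (hcone (-P))" using h(1) holo_on_subset by blast
  then have "holo_on (flip P f) (hcone (-P))"
    by (rule holo_on_cong) (auto simp: flip_def)
  moreover have "holo_on ?G (hcone (-P))" using h(2) holo_on_subset by blast
  ultimately show ?thesis
    by (rule Aut_I) (auto simp: flip_def F G GF FG)
qed

text \<open>The entire extension of \<open>f\<close> also extends \<open>flip P f\<close> from the
  opposite cone; by uniqueness, flipping back merely restricts it to the original cone.\<close>

lemma flip_flip:
  fixes P :: "'n::finite set"
  assumes P: "2 \<le> card P" "-P \<noteq> {}" and f: "f \<in> Aut (hcone P)"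
  shows "flip (-P) (flip P f) = f"
proof
  fix x
  have "entire_ext (-P) (flip P f) = entire_ext P f"
    by (rule entire_ext_unique) (use P entire_ext[OF P(1) AutD(1)[OF f]] in \<open>auto simp: flip_def\<close>)
  then show "flip (-P) (flip P f) x = f x"
    using entire_ext[OF P(1) AutD(1)[OF f]] AutD(3)[OF f] by (auto simp: flip_def)
qed

lemma flip_compose:
  fixes P :: "'n::finite set"
  assumes P: "2 \<le> card P" and f: "f \<in> Aut (hcone P)" and g: "g \<in> Aut (hcone P)"
  shows "flip P (f \<circ> g) = flip P f \<circ> flip P g"
proof
  fix x
  note ext = entire_ext[OF P AutD(1)[OF f]] entire_ext[OF P AutD(1)[OF g]]
  have "entire_ext P (f \<circ> g) = entire_ext P f \<circ> entire_ext P g"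
  proof (rule entire_ext_unique)
    show "holo_on (entire_ext P f \<circ> entire_ext P g) UNIV"
      by (rule holo_on_compose[where T=UNIV]) (use ext in auto)
  qed (use P ext AutD(2)[OF g] in auto)
  moreover have "flip P g x \<in> hcone (-P)" if "x \<in> hcone (-P)"
    using AutD(2)[OF flip_in_Aut[OF P g]] that by blast
  ultimately show "flip P (f \<circ> g) x = (flip P f \<circ> flip P g) x"
    by (auto simp: flip_def)
qed

text \<open>Over a compact \<open>K\<close> in the opposite cone, \<open>flip P h\<close> is a mean
  of \<open>h\<close> over circles that sweep out a compact \<open>C\<close> in the original cone.
  Uniform convergence on \<open>C\<close> thus passes to \<open>K\<close>.\<close>

lemma flip_loc_unif_conv:
  fixes P :: "'n::finite set"
  assumes P: "2 \<le> card P" and F: "\<And>k. F k \<in> Aut (hcone P)" and f: "f \<in> Aut (hcone P)"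
    and conv: "loc_unif_conv (hcone P) F f"
  shows "loc_unif_conv (hcone (-P)) (\<lambda>k. flip P (F k)) (flip P f)"
  unfolding loc_unif_conv_def
proof (intro allI impI, elim conjE)
  fix K assume K: "compact K" "K \<subseteq> hcone (-P)"
  obtain a where a: "a \<in> P" using P by fastforce
  obtain B where B: "\<And>x. x \<in> K \<Longrightarrow> norm x \<le> B"
    using K(1) compact_imp_bounded bounded_iff by metis
  \<comment> \<open>A single radius that suits every point of \<open>K\<close>.\<close>
  define \<rho> where "\<rho> = 2 * B + 1"
  have \<rho>: "2 * norm x < \<rho>" if "x \<in> K" for x using B[OF that] by (simp add: \<rho>_def)
  let ?c = "\<lambda>(x::complex^'n, t). x + axis a (circlepath 0 \<rho> t)"
  define C where "C = ?c ` (K \<times> {0..1})"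
  have "compact C" unfolding C_def
    by (intro compact_continuous_image compact_Times K) (auto simp: case_prod_beta intro!: continuous_intros)
  moreover have CP: "C \<subseteq> hcone P" unfolding C_def using circle_in_hcone[OF a \<rho>] by auto
  ultimately have lim: "uniform_limit C F f sequentially" using conv unfolding loc_unif_conv_def by blast
  have form: "flip P h x = circle_mean a \<rho> h x" if "x \<in> K" "h \<in> Aut (hcone P)" for h x
    using entire_eq_circle_mean[OF entire_ext[OF P AutD(1)[OF that(2)]] a \<rho>[OF that(1)]] that K(2)
    by (auto simp: flip_def)
  have ci: "continuous_on {0..1} (\<lambda>t. h (x + axis a (circlepath 0 \<rho> t)))"
    if "x \<in> K" "h \<in> Aut (hcone P)" for h x
    using circle_in_hcone[OF a \<rho>[OF that(1)]]
    by (intro continuous_on_compose2[OF holo_on_imp_continuous_on[OF AutD(1)[OF that(2)]]] continuous_intros) auto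
  show "uniform_limit K (\<lambda>k. flip P (F k)) (flip P f) sequentially"
  proof (rule uniform_limitI)
    fix e :: real assume "e > 0"
    then have "\<forall>\<^sub>F k in sequentially. \<forall>x\<in>C. dist (F k x) (f x) < e / 2"
      using uniform_limitD[OF lim, of "e / 2"] by simp
    then show "\<forall>\<^sub>F k in sequentially. \<forall>x\<in>K. dist (flip P (F k) x) (flip P f x) < e"
    proof eventually_elim
      case (elim k)
      show ?case
      proof
        fix x assume x: "x \<in> K"
        let ?y = "\<lambda>t. x + axis a (circlepath 0 \<rho> t)"
        have "flip P (F k) x - flip P f x = integral {0..1} (\<lambda>t. F k (?y t) - f (?y t))"
          unfolding form[OF x F] form[OF x f] circle_mean_def
          by (intro integral_diff[symmetric] integrable_continuous_interval ci x F f)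
        also have "norm \<dots> \<le> e / 2 * (1 - 0)"
        proof (rule integral_bound)
          show "continuous_on {0..1} (\<lambda>t. F k (?y t) - f (?y t))"
            by (intro continuous_intros ci x F f)
          fix t :: real assume "t \<in> {0..1}"
          then have "?y t \<in> C" unfolding C_def using x by auto
          then show "norm (F k (?y t) - f (?y t)) \<le> e / 2" using elim by (auto simp: dist_norm intro: less_imp_le)
        qed simp
        finally show "dist (flip P (F k) x) (flip P f x) < e" using \<open>e > 0\<close> by (simp add: dist_norm)
      qed
    qed
  qed
qed

text \<open>The inverse is \<open>flip (-P)\<close>, and its continuity is the same convergence
  lemma applied to the complementary block.\<close>

lemma aut_iso_flip:
  fixes P :: "'n::finite set"
  assumes P: "2 \<le> card P" "2 \<le> card (-P)"
  shows "aut_iso (hcone P) (hcone (-P)) (flip P)"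
proof -
  have ne: "P \<noteq> {}" "-P \<noteq> {}" using P by (metis card.empty not_numeral_le_zero)+
  have "bij_betw (flip P) (Aut (hcone P)) (Aut (hcone (-P)))"
    by (rule bij_betw_byWitness[where f'="flip (-P)"])
       (use flip_flip[of P] flip_flip[of "-P"] flip_in_Aut[of P] flip_in_Aut[of "-P"] P ne in auto)
  moreover have "loc_unif_conv (hcone P) F f"
    if F: "\<And>k. F k \<in> Aut (hcone P)" and f: "f \<in> Aut (hcone P)"
      and conv: "loc_unif_conv (hcone (-P)) (\<lambda>k. flip P (F k)) (flip P f)" for F f
    using flip_loc_unif_conv[OF P(2) flip_in_Aut[OF P(1) F] flip_in_Aut[OF P(1) f] conv]
    by (simp add: flip_flip P ne F f)
  ultimately show ?thesis
    unfolding aut_iso_def using flip_compose[OF P(1)] flip_loc_unif_conv[OF P(1)] by blast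
qed

section \<open>Homogeneity\<close>

definition hform :: "'n set \<Rightarrow> complex ^ 'n \<Rightarrow> complex ^ 'n \<Rightarrow> complex" where
  "hform P x y = (\<Sum>i\<in>UNIV. (if i \<in> P then 1 else -1) * x $ i * cnj (y $ i))"

lemma hform_add_left: "hform P (x + y) z = hform P x z + hform P y z"
  by (simp add: hform_def sum.distrib algebra_simps)

lemma hform_scale_left: "hform P (c *s x) z = c * hform P x z"
  by (simp add: hform_def sum_distrib_left algebra_simps)

lemma cnj_hform: "cnj (hform P x y) = hform P y x"
  unfolding hform_def cnj_sum by (rule sum.cong) auto

lemma hform_diff_left: "hform P (x - y) z = hform P x z - hform P y z"
  using hform_add_left[of P "x - y" y z] by simp

lemma hform_add_right: "hform P z (x + y) = hform P z x + hform P z y"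
  by (metis cnj_hform complex_cnj_add hform_add_left)

lemma hform_diff_right: "hform P z (x - y) = hform P z x - hform P z y"
  by (metis cnj_hform complex_cnj_diff hform_diff_left)

lemma hform_scale_right: "hform P z (c *s x) = cnj c * hform P z x"
  by (metis cnj_hform complex_cnj_mult hform_scale_left)

lemma hform_self_real: "hform P x x = of_real (Re (hform P x x))"
  using cnj_hform[of P x x] by (simp add: complex_eq_iff)

lemma hform_self:
  "Re (hform P x x) = (\<Sum>i\<in>P. (norm (x $ i))\<^sup>2) - (\<Sum>i\<in>-P. (norm (x $ i))\<^sup>2)"
proof -
  have "Re (hform P x x) = (\<Sum>i\<in>UNIV. if i \<in> P then (norm (x $ i))\<^sup>2 else - (norm (x $ i))\<^sup>2)"
    unfolding hform_def Re_sum
    by (rule sum.cong) (auto simp: cmod_power2, auto simp: power2_eq_square)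
  also have "\<dots> = (\<Sum>i\<in>P. (norm (x $ i))\<^sup>2) + (\<Sum>i\<in>-P. - (norm (x $ i))\<^sup>2)"
    by (subst sum.If_cases) (auto simp: Compl_eq)
  finally show ?thesis by (simp add: sum_negf)
qed

lemma mem_hcone_iff: "x \<in> hcone P \<longleftrightarrow> Re (hform P x x) > 0"
  by (simp add: hform_self hcone_def)

lemma Re_hform_scale: "Re (hform P (c *s x) (c *s x)) = (norm c)\<^sup>2 * Re (hform P x x)"
proof -
  have "hform P (c *s x) (c *s x) = (c * cnj c) * hform P x x"
    by (simp add: hform_scale_left hform_scale_right)
  also have "\<dots> = of_real ((norm c)\<^sup>2 * Re (hform P x x))"
    by (subst hform_self_real) (simp add: complex_mult_cnj cmod_power2)
  finally show ?thesis by simp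
qed

lemma scale_in_hcone: "c \<noteq> 0 \<Longrightarrow> c *s x \<in> hcone P \<longleftrightarrow> x \<in> hcone P"
  by (simp add: mem_hcone_iff Re_hform_scale zero_less_mult_iff)

text \<open>Rotating \<open>y\<close> by a unit scalar changes neither its cone nor its length and
  makes the cross term real and nonnegative. This controls the mixed terms in the proofs of
  connectedness and homogeneity.\<close>

lemma hform_phase:
  obtains c where "norm c = 1" "hform P x (c *s y) = of_real (norm (hform P x y))"
proof -
  define w where "w = hform P x y"
  define c where "c = (if w = 0 then 1 else sgn w)"
  have "norm c = 1" by (simp add: c_def norm_sgn)
  moreover have "cnj c * w = of_real (norm w)"
    by (cases "w = 0") (auto simp: c_def sgn_eq complex_norm_square[symmetric] mult.commute[of "cnj w"]
        power2_eq_square)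
  ultimately show ?thesis using that[of c] by (simp add: hform_scale_right w_def)
qed

text \<open>Once \<open>y\<close> is rotated to \<open>z\<close>, the form along the segment from
  \<open>x\<close> to \<open>z\<close> is a sum of nonnegative terms, not all zero. The circle of
  unit multiples of \<open>y\<close> then joins \<open>z\<close> to \<open>y\<close> inside the
  cone.\<close>

lemma connected_hcone: "connected (hcone P)"
  unfolding connected_iff_connected_component
proof (intro ballI)
  fix x y assume x: "x \<in> hcone P" and y: "y \<in> hcone P"
  obtain c where c: "norm c = 1" "hform P x (c *s y) = of_real (norm (hform P x y))"
    using hform_phase .
  define z where "z = c *s y"
  define T where "T = closed_segment x z \<union> (\<lambda>t. t *s y) ` sphere 0 1"
  have z: "z \<in> hcone P" unfolding z_def using c y by (subst scale_in_hcone) auto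
  have "connected ((\<lambda>t. t *s y) ` sphere (0::complex) 1)"
    by (intro connected_continuous_image connected_sphere
        bounded_linear.continuous_on[OF bounded_linear_scalar_mult_left]) (auto intro: continuous_intros)
  moreover have "z \<in> closed_segment x z \<inter> (\<lambda>t. t *s y) ` sphere 0 1"
    using c by (auto simp: z_def)
  ultimately have "connected T" unfolding T_def by (intro connected_Un) auto
  moreover have "closed_segment x z \<subseteq> hcone P"
  proof
    fix w assume "w \<in> closed_segment x z"
    then obtain s where s: "0 \<le> s" "s \<le> 1" "w = (1 - s) *\<^sub>R x + s *\<^sub>R z" by (auto simp: in_segment)
    have w: "w = of_real (1 - s) *s x + of_real s *s z"
      unfolding s(3) by (simp add: vec_eq_iff) (simp add: scaleR_conv_of_real algebra_simps)
    have zx: "hform P z x = hform P x z"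
      using cnj_hform[of P x z] c(2) by (simp add: z_def)
    have "hform P w w = of_real ((1 - s)\<^sup>2) * hform P x x + of_real (2 * s * (1 - s)) * hform P x z
        + of_real (s\<^sup>2) * hform P z z"
      unfolding w hform_add_left hform_add_right hform_scale_left hform_scale_right zx
      by (simp add: power2_eq_square algebra_simps)
    then have q: "Re (hform P w w) = (1 - s)\<^sup>2 * Re (hform P x x) + (2 * s * (1 - s)) * norm (hform P x y)
        + s\<^sup>2 * Re (hform P z z)"
      unfolding z_def c(2) by (simp add: power2_eq_square)
    have "(1 - s)\<^sup>2 * Re (hform P x x) + s\<^sup>2 * Re (hform P z z) > 0"
    proof (cases "s = 0")
      case False
      then have "s\<^sup>2 * Re (hform P z z) > 0" using z by (simp add: mem_hcone_iff)
      then show ?thesis using x by (simp add: mem_hcone_iff add_nonneg_pos)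
    qed (use x in \<open>simp add: mem_hcone_iff\<close>)
    moreover have "(2 * s * (1 - s)) * norm (hform P x y) \<ge> 0" using s by simp
    ultimately show "w \<in> hcone P" unfolding mem_hcone_iff q by linarith
  qed
  moreover have "t *s y \<in> hcone P" if "t \<in> sphere 0 1" for t
    using that y by (subst scale_in_hcone) auto
  moreover have "y \<in> (\<lambda>t. t *s y) ` sphere 0 1" by (rule image_eqI[of _ _ 1]) auto
  ultimately show "connected_component (hcone P) x y"
    unfolding connected_component_def by (intro exI[of _ T]) (auto simp: T_def)
qed

section \<open>Linear automorphisms and transitivity\<close>

lemma holo_on_clinear:
  fixes A :: "complex ^ 'n \<Rightarrow> complex ^ 'm"
  assumes "\<And>v w. A (v + w) = A v + A w" "\<And>c v. A (c *s v) = c *s A v"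
  shows "holo_on A S"
proof -
  have scaleR: "r *\<^sub>R v = of_real r *s v" for r and v :: "complex ^ 'k"
    by (simp add: vec_eq_iff) (simp add: scaleR_conv_of_real)
  have "linear A" by (rule linearI) (simp_all add: assms scaleR)
  then show ?thesis unfolding holo_on_def using assms linear_imp_has_derivative by blast
qed

lemma clinear_restrict_in_Aut:
  fixes A B :: "complex ^ 'n \<Rightarrow> complex ^ 'n"
  assumes "open D" "\<And>v w. A (v + w) = A v + A w" "\<And>c v. A (c *s v) = c *s A v"
    "\<And>v w. B (v + w) = B v + B w" "\<And>c v. B (c *s v) = c *s B v"
    "\<And>v. A (B v) = v" "\<And>v. B (A v) = v" "\<And>v. A v \<in> D \<longleftrightarrow> v \<in> D"
  shows "(\<lambda>v. if v \<in> D then A v else v) \<in> Aut D"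
proof (rule Aut_I[where g=B])
  show "holo_on (\<lambda>v. if v \<in> D then A v else v) D"
    by (rule holo_on_cong[OF holo_on_clinear[of A] assms(1)]) (use assms in auto)
  show "holo_on B D" using assms by (intro holo_on_clinear)
  have B: "B x \<in> D \<longleftrightarrow> x \<in> D" for x using assms(8)[of "B x"] assms(6) by simp
  then show "B x \<in> D" if "x \<in> D" for x using that by simp
  show "(if B x \<in> D then A (B x) else B x) = x" if "x \<in> D" for x using B assms that by simp
qed (use assms in auto)

text \<open>Reflections of an indefinite Hermitian form act transitively on vectors of equal positive
  length up to a phase, chosen here so that the mirror vector is not isotropic.\<close>

lemma homogeneous_hcone: "homogeneous (hcone P)"
  unfolding homogeneous_def
proof (intro ballI)
  fix x y assume x: "x \<in> hcone P" and y: "y \<in> hcone P"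
  \<comment> \<open>Rescales \<open>y\<close> to the length of \<open>x\<close>.\<close>
  define k where "k = sqrt (Re (hform P x x) / Re (hform P y y))"
  have pos: "Re (hform P x x) > 0" "Re (hform P y y) > 0" using x y by (auto simp: mem_hcone_iff)
  have k: "k > 0" "k\<^sup>2 * Re (hform P y y) = Re (hform P x x)"
    using pos by (auto simp: k_def)
  obtain c' where c': "norm c' = 1" "hform P x (c' *s (of_real k *s y)) = of_real (norm (hform P x (of_real k *s y)))"
    using hform_phase .
  define r where "r = norm (hform P x (of_real k *s y))"
  \<comment> \<open>The minus sign makes \<open>hform P x z\<close> equal to \<open>- r\<close>, so
    the mirror vector \<open>x - z\<close> has length
    \<open>m = 2 * (Re (hform P x x) + r) > 0\<close>.\<close>
  define \<mu> where "\<mu> = - c' * of_real k"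
  have \<mu>: "\<mu> \<noteq> 0" "norm \<mu> = k" using c' k by (auto simp: \<mu>_def norm_mult)
  define z where "z = \<mu> *s y"
  have xz: "hform P x z = - of_real r"
  proof -
    have "hform P x z = - hform P x (c' *s (of_real k *s y))"
      unfolding z_def \<mu>_def hform_scale_right by simp
    then show ?thesis unfolding c'(2) r_def .
  qed
  then have zx: "hform P z x = - of_real r" using cnj_hform[of P x z] by simp
  have zz: "hform P z z = hform P x x"
  proof -
    have "Re (hform P z z) = Re (hform P x x)"
      unfolding z_def Re_hform_scale \<mu>(2) by (rule k(2))
    then show ?thesis by (metis hform_self_real)
  qed
  define d where "d = x - z"
  define m where "m = 2 * (Re (hform P x x) + r)"
  have "m > 0" using pos by (simp add: m_def r_def add_pos_nonneg)
  have xx: "hform P x x = of_real (Re (hform P x x))" by (rule hform_self_real)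
  have xd: "hform P x d = of_real (m / 2)"
    unfolding d_def hform_diff_right xz by (subst xx) (simp add: m_def)
  have "hform P d d = of_real m"
    unfolding d_def hform_diff_left hform_diff_right xz zx zz by (subst (1 2) xx) (simp add: m_def)
  note dd = this
  \<comment> \<open>The unitary reflection negating \<open>d\<close>. As \<open>hform P x d\<close>
    is half of \<open>hform P d d\<close>, it subtracts exactly \<open>d\<close> from
    \<open>x\<close> and yields \<open>z\<close>.\<close>
  define R where "R v = v - (2 * hform P v d / of_real m) *s d" for v
  have "R x = x - d" using \<open>m > 0\<close> by (simp add: R_def xd)
  then have Rx: "R x = z" by (simp add: d_def)
  have Radd: "R (v + w) = R v + R w" for v w
    unfolding R_def hform_add_left by (simp add: vec_eq_iff algebra_simps add_divide_distrib)
  have Rscale: "R (a *s v) = a *s R v" for a v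
    unfolding R_def hform_scale_left by (simp add: vec_eq_iff algebra_simps)
  have "hform P (R v) d = - hform P v d" for v
    unfolding R_def hform_diff_left hform_scale_left dd using \<open>m > 0\<close> by simp
  then have RR: "R (R v) = v" for v
    unfolding R_def[of "R v"] by (simp add: R_def vec_eq_iff)
  have Rh: "hform P (R v) (R v) = hform P v v" for v
    unfolding R_def hform_diff_left hform_diff_right hform_scale_left hform_scale_right dd
    using \<open>m > 0\<close> cnj_hform[of P v d] by (simp add: field_simps)
  have RD: "R v \<in> hcone P \<longleftrightarrow> v \<in> hcone P" for v by (simp add: mem_hcone_iff Rh)
  \<comment> \<open>Dividing by \<open>\<mu>\<close> undoes the scaling
    \<open>z = \<mu> *s y\<close>, so \<open>x\<close> goes to \<open>y\<close> itself.\<close>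
  define A where "A v = (1 / \<mu>) *s R v" for v
  define B where "B v = R (\<mu> *s v)" for v
  have "(\<lambda>v. if v \<in> hcone P then A v else v) \<in> Aut (hcone P)"
  proof (rule clinear_restrict_in_Aut[where B=B])
    show "A v \<in> hcone P \<longleftrightarrow> v \<in> hcone P" for v
      unfolding A_def using \<mu> RD by (subst scale_in_hcone) auto
    show "A (B v) = v" "B (A v) = v" for v
      unfolding A_def B_def using \<mu> by (simp_all add: Rscale RR)
  qed (simp_all add: A_def B_def Radd Rscale vec.scale_right_distrib mult.commute)
  moreover have "A x = y" using \<mu> by (simp add: A_def Rx z_def)
  ultimately show "\<exists>f\<in>Aut (hcone P). f x = y" using x by (intro bexI) auto
qed

section \<open>Topology of the cones\<close>

lemma not_bounded_hcone:
  assumes "P \<noteq> {}" shows "\<not> bounded (hcone P)"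
proof
  assume "bounded (hcone P)"
  then obtain B where B: "\<And>x. x \<in> hcone P \<Longrightarrow> norm x \<le> B" unfolding bounded_iff by blast
  obtain a where a: "a \<in> P" using assms by blast
  have "norm (axis a (of_real (\<bar>B\<bar> + 1)) :: complex ^ 'a) \<le> B"
    by (intro B axis_in_hcone a) (simp del: of_real_add)
  then show False unfolding norm_axis norm_of_real by linarith
qed

section \<open>Homotopy type of the cones\<close>

definition coord_subspace :: "'n set \<Rightarrow> (complex ^ 'n) set" where
  "coord_subspace P = {x. \<forall>i. i \<notin> P \<longrightarrow> x $ i = 0}"

lemma subspace_coord_subspace: "subspace (coord_subspace P)"
  by (auto simp: coord_subspace_def subspace_def)

text \<open>The dimension is real: each complex coordinate in \<open>P\<close> contributes two
  standard basis vectors.\<close>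

lemma dim_coord_subspace:
  fixes P :: "'n::finite set"
  shows "dim (coord_subspace P) = 2 * card P"
proof -
  define d :: "(complex ^ 'n) set" where "d = (\<lambda>(i, u). axis i u) ` (P \<times> Basis)"
  have "d \<subseteq> Basis" unfolding d_def by (auto simp: Basis_vec_def)
  have "coord_subspace P = {x. \<forall>i\<in>Basis. i \<notin> d \<longrightarrow> x \<bullet> i = 0}"
  proof (intro equalityI subsetI)
    fix x assume x: "x \<in> coord_subspace P"
    have "x \<bullet> b = 0" if b: "b \<in> Basis" "b \<notin> d" for b
    proof -
      obtain i u where "b = axis i u" "u \<in> Basis" using b(1) unfolding Basis_vec_def by blast
      moreover from this b(2) have "i \<notin> P" by (auto simp: d_def)
      ultimately show ?thesis using x by (simp add: inner_axis coord_subspace_def)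
    qed
    then show "x \<in> {x. \<forall>i\<in>Basis. i \<notin> d \<longrightarrow> x \<bullet> i = 0}" by blast
  next
    fix x assume x: "x \<in> {x. \<forall>i\<in>Basis. i \<notin> d \<longrightarrow> x \<bullet> i = 0}"
    have "x $ i = 0" if "i \<notin> P" for i
    proof (rule euclidean_eqI)
      fix u :: complex assume u: "u \<in> Basis"
      then have "axis i u \<in> Basis" by (auto simp: Basis_vec_def)
      moreover have "axis i u \<notin> d" using that u by (auto simp: d_def axis_eq_axis)
      ultimately have "x \<bullet> axis i u = 0" using x by blast
      then show "x $ i \<bullet> u = 0 \<bullet> u" by (simp add: inner_axis)
    qed
    then show "x \<in> coord_subspace P" by (simp add: coord_subspace_def)
  qed
  then have "dim (coord_subspace P) = card d" using dim_substandard[OF \<open>d \<subseteq> Basis\<close>] by simp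
  also have "\<dots> = card (P \<times> (Basis :: complex set))"
    unfolding d_def by (rule card_image) (auto simp: inj_on_def axis_eq_axis)
  finally show ?thesis by (simp add: card_cartesian_product)
qed

text \<open>Shrinking the coordinates outside \<open>P\<close> linearly to zero only lowers the
  negative part of the form, so the cone deforms within itself onto its points supported in
  \<open>P\<close>.\<close>

lemma hcone_homotopy_eqv_punctured:
  fixes P :: "'n::finite set"
  shows "hcone P homotopy_eqv (coord_subspace P - {0})"
proof (rule deformation_retract_imp_homotopy_eqv)
  let ?r = "\<lambda>x. (\<chi> i. if i \<in> P then x $ i else 0) :: complex ^ 'n"
  have cont: "continuous_on (hcone P) ?r"
  proof (rule continuous_on_vec_lambda)
    show "continuous_on (hcone P) (\<lambda>x. if i \<in> P then x $ i else 0)" for i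
      by (cases "i \<in> P") (auto intro: continuous_intros)
  qed
  show "homotopic_with_canon (\<lambda>x. True) (hcone P) (hcone P) id ?r"
  proof (rule homotopic_with_linear)
    fix x assume x: "x \<in> hcone P"
    show "closed_segment (id x) (?r x) \<subseteq> hcone P"
    proof
      fix w assume "w \<in> closed_segment (id x) (?r x)"
      then obtain s where s: "0 \<le> s" "s \<le> 1" "w = (1 - s) *\<^sub>R x + s *\<^sub>R ?r x" by (auto simp: in_segment)
      have "w $ i = (1 - s) *\<^sub>R x $ i + s *\<^sub>R x $ i" if "i \<in> P" for i
        unfolding s(3) using that by simp
      then have P: "w $ i = x $ i" if "i \<in> P" for i
        using that by (simp flip: scaleR_add_left)
      have nP: "w $ i = (1 - s) *\<^sub>R x $ i" if "i \<notin> P" for i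
        unfolding s(3) using that by simp
      have "(\<Sum>i\<in>-P. (norm (w $ i))\<^sup>2) \<le> (\<Sum>i\<in>-P. (norm (x $ i))\<^sup>2)"
      proof (intro sum_mono power_mono)
        fix i assume "i \<in> -P"
        then have "norm (w $ i) = (1 - s) * norm (x $ i)" using nP s by simp
        also have "\<dots> \<le> norm (x $ i)" using s by (simp add: mult_left_le_one_le)
        finally show "norm (w $ i) \<le> norm (x $ i)" .
      qed auto
      also have "\<dots> < (\<Sum>i\<in>P. (norm (w $ i))\<^sup>2)" using x P by (simp add: hcone_def)
      finally show "w \<in> hcone P" by (simp add: hcone_def)
    qed
  qed (auto intro: cont)
  show "retraction (hcone P) (coord_subspace P - {0}) ?r"
    unfolding retraction_def
  proof (intro conjI ballI cont)
    show "coord_subspace P - {0} \<subseteq> hcone P"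
    proof
      fix x assume x: "x \<in> coord_subspace P - {0}"
      then obtain i where i: "x $ i \<noteq> 0" by (auto simp: vec_eq_iff)
      then have "i \<in> P" using x by (auto simp: coord_subspace_def)
      moreover have "(\<Sum>i\<in>-P. (norm (x $ i))\<^sup>2) = 0"
        using x by (intro sum.neutral) (auto simp: coord_subspace_def)
      ultimately show "x \<in> hcone P" using i by (intro hconeI) auto
    qed
    show "?r \<in> hcone P \<rightarrow> coord_subspace P - {0}"
    proof
      fix x assume x: "x \<in> hcone P"
      have "\<exists>i\<in>P. x $ i \<noteq> 0"
      proof (rule ccontr)
        assume "\<not> ?thesis"
        then have "(\<Sum>i\<in>P. (norm (x $ i))\<^sup>2) = 0" by simp
        then show False using x sum_nonneg[of "-P" "\<lambda>i. (norm (x $ i))\<^sup>2"] by (simp add: hcone_def)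
      qed
      then show "?r x \<in> coord_subspace P - {0}" by (auto simp: coord_subspace_def vec_eq_iff)
    qed
    show "?r x = x" if "x \<in> coord_subspace P - {0}" for x
      using that by (auto simp: coord_subspace_def vec_eq_iff)
  qed
qed

text \<open>Its relative frontier is the unit sphere of the coordinate subspace. Presenting spheres
  this way allows those in subspaces of different dimensions to be compared through
  \<open>aff_dim\<close>.\<close>

definition coord_ball :: "'n set \<Rightarrow> (complex ^ 'n) set" where
  "coord_ball P = cball 0 1 \<inter> coord_subspace P"

lemma coord_ball:
  shows "convex (coord_ball P)" "bounded (coord_ball P)" "aff_dim (coord_ball P) = 2 * card P"
    and rel_frontier_coord_ball: "rel_frontier (coord_ball P) homotopy_eqv hcone P"
proof -
  let ?V = "coord_subspace P"
  have V: "affine ?V" "convex ?V" "0 \<in> ?V"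
    using subspace_coord_subspace[of P] by (auto simp: subspace_imp_affine subspace_imp_convex subspace_0)
  show c: "convex (coord_ball P)" and b: "bounded (coord_ball P)"
    unfolding coord_ball_def using V by (auto intro: convex_Int bounded_Int)
  have hull: "affine hull (coord_ball P) = ?V"
    unfolding coord_ball_def Int_commute[of "cball 0 1"]
    by (subst affine_hull_convex_Int_nonempty_interior) (use V in \<open>auto simp: hull_same\<close>)
  have "aff_dim ?V = int (dim ?V)" by (rule aff_dim_subspace[OF subspace_coord_subspace])
  then show "aff_dim (coord_ball P) = 2 * card P"
    using dim_coord_subspace[of P] hull aff_dim_affine_hull[of "coord_ball P"] by simp
  have "0 \<in> rel_interior (coord_ball P)"
  proof -
    have "interior (cball 0 1) \<inter> ?V \<noteq> {}" using V(3) by force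
    then show ?thesis unfolding coord_ball_def
      using V by (subst rel_interior_convex_Int_affine) auto
  qed
  then have "rel_frontier (coord_ball P) homotopy_eqv (?V - {0})"
    using homotopy_eqv_rel_frontier_punctured_affine_hull[OF c b, of 0] hull by simp
  then show "rel_frontier (coord_ball P) homotopy_eqv hcone P"
    using hcone_homotopy_eqv_punctured[of P] homotopy_equivalent_space_sym homotopy_eqv_trans by blast
qed

lemma biholo_equiv_imp_homeomorphic:
  assumes "biholo_equiv A B" shows "A homeomorphic B"
proof -
  obtain f g where "holo_on f A" "bij_betw f A B" "holo_on g B" "\<forall>x\<in>A. g (f x) = x"
    using assms unfolding biholo_equiv_def biholo_def by blast
  then have "homeomorphism A B f g"
    unfolding homeomorphism_def bij_betw_def
    by (auto simp: holo_on_imp_continuous_on image_image)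
  then show ?thesis using homeomorphic_def by blast
qed

text \<open>A biholomorphism would make a 3-sphere \<open>?S\<close> homotopy equivalent to a sphere
  \<open>?T\<close> of larger dimension. Maps from \<open>?S\<close> to \<open>?T\<close> are
  null-homotopic, so the identity of \<open>?S\<close> would be too, making a sphere
  contractible.\<close>

lemma hcone_not_biholo_equiv:
  fixes P :: "'n::finite set"
  assumes P: "card P = 2" "2 < card (-P)"
  shows "\<not> biholo_equiv (hcone P) (hcone (-P))"
proof
  assume "biholo_equiv (hcone P) (hcone (-P))"
  then have "hcone P homotopy_eqv hcone (-P)"
    using biholo_equiv_imp_homeomorphic homeomorphic_imp_homotopy_eqv by blast
  let ?S = "rel_frontier (coord_ball P)" and ?T = "rel_frontier (coord_ball (-P))"
  have eqv: "?T homotopy_eqv ?S"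
    using rel_frontier_coord_ball[of P] rel_frontier_coord_ball[of "-P"]
      \<open>hcone P homotopy_eqv hcone (-P)\<close>
      homotopy_equivalent_space_sym homotopy_eqv_trans by metis
  have "\<exists>c. homotopic_with_canon (\<lambda>x. True) ?S ?T f (\<lambda>x. c)"
    if "continuous_on ?S f" "f \<in> ?S \<rightarrow> ?T" for f
    using inessential_spheremap_lowdim_gen[OF coord_ball(1,2) coord_ball(1,2) _ that] P
    by (metis coord_ball(3) mult_less_cancel1 of_nat_less_iff pos2 of_nat_mult of_nat_numeral)
  then have "\<exists>c. homotopic_with_canon (\<lambda>x. True) ?S ?S id (\<lambda>x. c)"
    by (intro homotopy_eqv_homotopic_triviality_null_imp[OF eqv]) auto
  then have "contractible ?S" by (simp add: contractible_def id_def)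
  \<comment> \<open>As \<open>card P = 2\<close>, the ball has real dimension 4, the dimension of
    \<open>complex ^ 2\<close>.\<close>
  moreover have "?S homeomorphic rel_frontier (cball 0 1 :: (complex ^ 2) set)"
    by (rule homeomorphic_rel_frontiers_convex_bounded_sets)
       (simp_all add: coord_ball P aff_dim_cball)
  ultimately show False
    using homeomorphic_contractible_eq[of ?S "sphere (0 :: complex ^ 2) 1"] contractible_sphere[of "0 :: complex ^ 2" 1] by (simp add: rel_frontier_cball)
qed

theorem theorem6p1:
  assumes "CARD('n::finite) \<ge> 5"
  shows "\<exists>(\<Omega>1 :: (complex ^ 'n) set) \<Omega>2.
           is_domain \<Omega>1 \<and> is_domain \<Omega>2 \<and> \<not> bounded \<Omega>1 \<and> \<not> bounded \<Omega>2 \<and>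
           homogeneous \<Omega>1 \<and> homogeneous \<Omega>2 \<and>
           \<not> biholo_equiv \<Omega>1 \<Omega>2 \<and> (\<exists>\<Phi>. aut_iso \<Omega>1 \<Omega>2 \<Phi>)"
proof -
  \<comment> \<open>With a block of size 2, the bound \<open>CARD('n) \<ge> 5\<close> leaves a
    strictly larger complement, so the two spheres have different dimensions.\<close>
  obtain P :: "'n set" where P: "card P = 2"
    using ex_card[of 2 "UNIV :: 'n set"] assms by auto
  then have cP: "card (-P) > 2" using assms card_Diff_subset[of P UNIV] by (simp add: Compl_eq_Diff_UNIV)
  have ne: "P \<noteq> {}" "-P \<noteq> {}" using P cP by (metis card.empty not_less_zero zero_neq_numeral)+
  have "is_domain (hcone Q)" if "Q \<noteq> {}" for Q :: "'n set"
    using that axis_in_hcone[of _ Q 1] connected_hcone[of Q] by (auto simp: is_domain_def)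
  then show ?thesis
    using ne not_bounded_hcone[of P] not_bounded_hcone[of "-P"] homogeneous_hcone
      hcone_not_biholo_equiv[OF P cP] aut_iso_flip[of P] P cP
    by (intro exI[of _ "hcone P"] exI[of _ "hcone (-P)"]) auto
qed

end
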